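(* Let $(X,d,A)$ be a metric pair with $A\neq\emptyset$ and $(X,d)$ complete, separable and boundedly compact. Let $\mu,\nu\in\mathcal{M}_1^+(X,A)$. Then $$W_1(\mu,\nu)=\sup\Bigl\{\int_X f\,d(\mu-\nu)\ \Big|\ f\in\mathrm{Lip}(X,A),\ L(f)\le1\Bigr\}.$$ Hence, viewing $\mu-\nu$ as a linear functional on $\mathrm{Lip}(X,A)$, we have $W_1(\mu,\nu)=\|\mu-\nu\|_{\mathrm{op}}$.
   Context: A metric pair $(X,d,A)$ is a metric space $(X,d)$ with a closed subset $A\subset X$; $d_A(x)=\inf_{a\in A}d(x,a)$. $X$ is boundedly compact if every closed bounded subset is compact. Measures take values in $[0,\infty]$. Let $\mathcal{B}^+(X)$ be the commutative monoid of Borel measures on $X$ and $\mathcal{B}^+(X,A)=\mathcal{B}^+(X)/\mathcal{B}^+(A)$ the quotient monoid: $\mu\sim\nu$ iff $\mu+\sigma=\nu+\tau$ for some Borel measures $\sigma,\tau$ concentrated on $A$; equivalently $\mu,\nu$ agree on Borel subsets of $X\setminus A$, so relative Borel measures correspond bijectively to Borel measures on $X\setminus A$. Integrals of functions vanishing on $A$ are well defined. $\mu$ is tight if $\mu(E)=\sup\{\mu(K): K\subset E \text{ compact}\}$ for every Borel $E\subset X\setminus A$. $\mathcal{M}_1^+(X,A)$ is the set of tight $\mu\in\mathcal{B}^+(X,A)$ with $\int d_A\,d\mu<\infty$. $\mathrm{Lip}(X,A)$ is the space of Lipschitz functions $f:X\to\mathbb{R}$ with $f|_A=0$, normed by the Lipschitz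 number $L(f)$ (least Lipschitz constant); $\|\cdot\|_{\mathrm{op}}$ is the operator norm with respect to $L$. For $f\in\mathrm{Lip}(X,A)$, $\int_X f\,d(\mu-\nu)=\int f\,d\mu-\int f\,d\nu$. The product pair is $(X\times X,d+d,A\times A)$, and $\mathcal{B}^+(X^2,A^2)$ is defined in the same way. The projections $p_1,p_2$ induce pushforwards $(p_i)_*:\mathcal{B}^+(X^2,A^2)\to\mathcal{B}^+(X,A)$. $\Pi(\mu,\nu)$ is the set of couplings, i.e. $\pi\in\mathcal{B}^+(X^2,A^2)$ with $(p_1)_*\pi=\mu$, $(p_2)_*\pi=\nu$. With $\bar d(x,y)=\min(d(x,y),d_A(x)+d_A(y))$, the relative $1$-Wasserstein distance is $W_1(\mu,\nu)=\inf_{\pi\in\Pi(\mu,\nu)}\int_{X\times X}\bar d\,d\pi$. *)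

theory Defs
  imports "HOL-Analysis.Analysis"
begin

section \<open>Relative Borel measures\<close>

definition borel_measures :: "'a::topological_space measure set" where
  "borel_measures = {M. sets M = sets borel}"

definition concentrated_on :: "'a measure \<Rightarrow> 'a set \<Rightarrow> bool" where
  "concentrated_on M A \<longleftrightarrow> emeasure M (- A) = 0"

text \<open>The congruence \<open>\<mu> + \<sigma> = \<nu> + \<tau>\<close>, with the equation of measures written out on Borel sets.\<close>

definition rel_measure_eq :: "'a::topological_space set \<Rightarrow> ('a measure \<times> 'a measure) set" where
  "rel_measure_eq A = {(\<mu>, \<nu>). \<mu> \<in> borel_measures \<and> \<nu> \<in> borel_measures \<and>
     (\<exists>\<sigma>\<in>borel_measures. \<exists>\<tau>\<in>borel_measures. concentrated_on \<sigma> A \<and> concentrated_on \<tau> A \<and>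
        (\<forall>E\<in>sets borel. emeasure \<mu> E + emeasure \<sigma> E = emeasure \<nu> E + emeasure \<tau> E))}"

type_synonym 'a relative_measure = "'a measure set"

definition relative_measures :: "'a::topological_space set \<Rightarrow> 'a relative_measure set" where
  "relative_measures A = borel_measures // rel_measure_eq A"

text \<open>
  The following notions are evaluated at an arbitrary representative of the class. This is
  independent of the choice for Borel subsets of the complement of \<open>A\<close> and for Borel functions
  vanishing on \<open>A\<close>; see \<open>rel_emeasure_eq\<close>, \<open>rel_nn_integral_eq\<close>, \<open>rel_integral_eq\<close> and
  \<open>rel_push_eq\<close> below.
\<close>

definition rel_rep :: "'a relative_measure \<Rightarrow> 'a measure" where
  "rel_rep P = (SOME \<mu>. \<mu> \<in> P)"

definition rel_emeasure :: "'a relative_measure \<Rightarrow> 'a set \<Rightarrow> ennreal" where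
  "rel_emeasure P E = emeasure (rel_rep P) E"

definition rel_nn_integral :: "'a relative_measure \<Rightarrow> ('a \<Rightarrow> ennreal) \<Rightarrow> ennreal" where
  "rel_nn_integral P f = (\<integral>\<^sup>+x. f x \<partial>rel_rep P)"

definition rel_integral :: "'a relative_measure \<Rightarrow> ('a \<Rightarrow> real) \<Rightarrow> real" where
  "rel_integral P f = (LINT x|rel_rep P. f x)"

definition rel_push ::
    "'b::topological_space set \<Rightarrow> ('a \<Rightarrow> 'b) \<Rightarrow> 'a relative_measure \<Rightarrow> 'b relative_measure" where
  "rel_push A p P = rel_measure_eq A `` {distr (rel_rep P) borel p}"

definition rel_tight :: "'a::topological_space set \<Rightarrow> 'a relative_measure \<Rightarrow> bool" where
  "rel_tight A P \<longleftrightarrow> (\<forall>E\<in>sets borel. E \<subseteq> - A \<longrightarrow>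
     rel_emeasure P E = (SUP K\<in>{K. compact K \<and> K \<subseteq> E}. rel_emeasure P K))"

definition M1 :: "'a::metric_space set \<Rightarrow> 'a relative_measure set" where
  "M1 A = {\<mu> \<in> relative_measures A. rel_tight A \<mu> \<and>
     rel_nn_integral \<mu> (\<lambda>x. ennreal (infdist x A)) < \<infinity>}"


section \<open>Couplings and the relative 1-Wasserstein distance\<close>

text \<open>
  The metric \<open>d + d\<close> on the product enters only through its topology, which is the product
  topology, i.e. the topology of the library instance for \<open>'a \<times> 'a\<close> (whose metric is the
  \<open>l\<^sup>2\<close> one).
\<close>

definition couplings ::
    "'a::topological_space set \<Rightarrow> 'a relative_measure \<Rightarrow> 'a relative_measure \<Rightarrow>
      ('a \<times> 'a) relative_measure set" where
  "couplings A \<mu> \<nu> =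
     {\<pi> \<in> relative_measures (A \<times> A). rel_push A fst \<pi> = \<mu> \<and> rel_push A snd \<pi> = \<nu>}"

definition dbar :: "'a::metric_space set \<Rightarrow> 'a \<Rightarrow> 'a \<Rightarrow> real" where
  "dbar A x y = min (dist x y) (infdist x A + infdist y A)"

definition W1 :: "'a::metric_space set \<Rightarrow> 'a relative_measure \<Rightarrow> 'a relative_measure \<Rightarrow> ennreal" where
  "W1 A \<mu> \<nu> = (INF \<pi>\<in>couplings A \<mu> \<nu>. rel_nn_integral \<pi> (\<lambda>(x, y). ennreal (dbar A x y)))"


section \<open>Lipschitz functions\<close>

definition Lip :: "'a::metric_space set \<Rightarrow> ('a \<Rightarrow> real) set" where
  "Lip A = {f. (\<exists>C. C-lipschitz_on UNIV f) \<and> (\<forall>x\<in>A. f x = 0)}"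

definition lip_number :: "('a::metric_space \<Rightarrow> real) \<Rightarrow> real" where
  "lip_number f = Inf {C. C-lipschitz_on UNIV f}"

definition diff_integral ::
    "'a relative_measure \<Rightarrow> 'a relative_measure \<Rightarrow> ('a \<Rightarrow> real) \<Rightarrow> real" where
  "diff_integral \<mu> \<nu> f = rel_integral \<mu> f - rel_integral \<nu> f"

text \<open>
  \<open>Lip A\<close> depends on \<open>A\<close> and so is not a type; the library constant \<open>onorm\<close> does not apply.
\<close>

definition lip_onorm :: "'a::metric_space set \<Rightarrow> (('a \<Rightarrow> real) \<Rightarrow> real) \<Rightarrow> ennreal" where
  "lip_onorm A \<phi> = (SUP f\<in>{f \<in> Lip A. lip_number f \<le> 1}. ennreal \<bar>\<phi> f\<bar>)"


section \<open>Well-definedness\<close>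

lemma rel_measure_eq_iff:
  fixes A :: "'a::topological_space set"
  assumes A: "A \<in> sets borel"
  shows "(\<mu>, \<nu>) \<in> rel_measure_eq A \<longleftrightarrow>
     sets \<mu> = sets borel \<and> sets \<nu> = sets borel \<and>
     (\<forall>E\<in>sets borel. E \<subseteq> - A \<longrightarrow> emeasure \<mu> E = emeasure \<nu> E)"
proof (intro iffI; (elim conjE)?)
  assume r: "(\<mu>, \<nu>) \<in> rel_measure_eq A"
  have "emeasure \<mu> E = emeasure \<nu> E" if E: "E \<in> sets borel" "E \<subseteq> - A" for E
  proof -
    from r obtain \<sigma> \<tau> where st: "sets \<sigma> = sets borel" "sets \<tau> = sets borel"
        "emeasure \<sigma> (- A) = 0" "emeasure \<tau> (- A) = 0"
        "\<forall>E\<in>sets borel. emeasure \<mu> E + emeasure \<sigma> E = emeasure \<nu> E + emeasure \<tau> E"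
      by (auto simp: rel_measure_eq_def borel_measures_def concentrated_on_def)
    have "emeasure \<sigma> E = 0" "emeasure \<tau> E = 0"
      using emeasure_mono[OF E(2), of \<sigma>] emeasure_mono[OF E(2), of \<tau>] st(1-4) borel_comp[OF A]
      by simp_all
    with st(5) E(1) show ?thesis
      by (metis add.right_neutral)
  qed
  with r show "sets \<mu> = sets borel \<and> sets \<nu> = sets borel \<and>
     (\<forall>E\<in>sets borel. E \<subseteq> - A \<longrightarrow> emeasure \<mu> E = emeasure \<nu> E)"
    by (simp add: rel_measure_eq_def borel_measures_def)
next
  assume s: "sets \<mu> = sets borel" "sets \<nu> = sets borel"
    and e: "\<forall>E\<in>sets borel. E \<subseteq> - A \<longrightarrow> emeasure \<mu> E = emeasure \<nu> E"
  let ?\<sigma> = "density \<nu> (indicator A)" and ?\<tau> = "density \<mu> (indicator A)"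
  have em: "emeasure (density M (indicator A)) E = emeasure M (A \<inter> E)"
    if "sets M = sets borel" "E \<in> sets borel" for M E
  proof -
    have i: "(indicator A :: 'a \<Rightarrow> ennreal) \<in> borel_measurable M"
      using that A by (intro borel_measurable_indicator) simp
    have "emeasure (density M (indicator A)) E = (\<integral>\<^sup>+x. indicator A x * indicator E x \<partial>M)"
      using that by (intro emeasure_density i) simp
    also have "\<dots> = (\<integral>\<^sup>+x. indicator (A \<inter> E) x \<partial>M)"
      by (simp add: indicator_inter_arith)
    also have "\<dots> = emeasure M (A \<inter> E)"
      using that A by (subst nn_integral_indicator) auto
    finally show ?thesis .
  qed
  have split: "emeasure M E = emeasure M (E - A) + emeasure M (A \<inter> E)"
    if "sets M = sets borel" "E \<in> sets borel" for M E
    using that A by (subst plus_emeasure) (auto intro!: arg_cong[where f="emeasure M"])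
  have "emeasure \<mu> E + emeasure ?\<sigma> E = emeasure \<nu> E + emeasure ?\<tau> E" if E: "E \<in> sets borel" for E
  proof -
    have "emeasure \<mu> (E - A) = emeasure \<nu> (E - A)"
      using e E A by (auto simp: sets.Diff)
    then show ?thesis
      using split[OF s(1) E] split[OF s(2) E] em[OF s(1) E] em[OF s(2) E]
      by (simp add: ac_simps)
  qed
  moreover have "emeasure ?\<sigma> (- A) = 0" "emeasure ?\<tau> (- A) = 0"
    using em[OF s(1), of "- A"] em[OF s(2), of "- A"] A by auto
  ultimately show "(\<mu>, \<nu>) \<in> rel_measure_eq A"
    unfolding rel_measure_eq_def borel_measures_def concentrated_on_def mem_Collect_eq prod.case
    by (intro conjI s bexI[of _ ?\<sigma>] bexI[of _ ?\<tau>]) (simp_all add: s)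
qed

lemma equiv_rel_measure_eq:
  fixes A :: "'a::topological_space set"
  assumes "A \<in> sets borel"
  shows "equiv borel_measures (rel_measure_eq A)"
  unfolding equiv_def refl_on_def sym_def trans_def
  by (auto simp: rel_measure_eq_iff[OF assms] borel_measures_def)

lemma rel_rep_in:
  assumes "A \<in> sets borel" "P \<in> relative_measures A"
  shows "rel_rep P \<in> P"
  unfolding rel_rep_def some_in_eq
  using in_quotient_imp_non_empty[OF equiv_rel_measure_eq[OF assms(1)]] assms(2)
  by (auto simp: relative_measures_def)

lemma rel_rep_related:
  assumes "A \<in> sets borel" "P \<in> relative_measures A" "\<mu> \<in> P"
  shows "(rel_rep P, \<mu>) \<in> rel_measure_eq A"
  using quotient_eq_iff[OF equiv_rel_measure_eq[OF assms(1)], of P P "rel_rep P" \<mu>]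
    rel_rep_in[OF assms(1,2)] assms(2,3)
  by (auto simp: relative_measures_def)

lemma sets_rel_rep:
  assumes "A \<in> sets borel" "P \<in> relative_measures A"
  shows "sets (rel_rep P) = sets borel"
  using rel_rep_related[OF assms rel_rep_in[OF assms]]
  by (simp add: rel_measure_eq_iff[OF assms(1)])

lemma rel_emeasure_eq:
  assumes "A \<in> sets borel" "P \<in> relative_measures A" "\<mu> \<in> P" "E \<in> sets borel" "E \<subseteq> - A"
  shows "rel_emeasure P E = emeasure \<mu> E"
  using rel_rep_related[OF assms(1-3)] assms(4,5)
  by (simp add: rel_emeasure_def rel_measure_eq_iff[OF assms(1)])

lemma restrict_space_rel_eq:
  assumes A: "A \<in> sets borel" and r: "(\<mu>, \<nu>) \<in> rel_measure_eq A"
  shows "restrict_space \<mu> (- A) = restrict_space \<nu> (- A)"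
proof (rule measure_eqI)
  have s: "sets \<mu> = sets borel" "sets \<nu> = sets borel"
    and e: "\<And>E. E \<in> sets borel \<Longrightarrow> E \<subseteq> - A \<Longrightarrow> emeasure \<mu> E = emeasure \<nu> E"
    using r by (auto simp: rel_measure_eq_iff[OF A])
  show "sets (restrict_space \<mu> (- A)) = sets (restrict_space \<nu> (- A))"
    by (simp add: sets_restrict_space s)
  fix E assume "E \<in> sets (restrict_space \<mu> (- A))"
  then have E: "E \<subseteq> - A" "E \<in> sets borel"
    by (auto simp: sets_restrict_space s(1) intro: sets.Int borel_comp[OF A])
  then show "emeasure (restrict_space \<mu> (- A)) E = emeasure (restrict_space \<nu> (- A)) E"
    using e[OF E(2,1)] borel_comp[OF A] sets_eq_imp_space_eq[OF s(1)] sets_eq_imp_space_eq[OF s(2)]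
    by (simp add: emeasure_restrict_space s)
qed

lemma rel_nn_integral_eq:
  assumes A: "A \<in> sets borel" and P: "P \<in> relative_measures A" "\<mu> \<in> P" and f: "\<And>x. x \<in> A \<Longrightarrow> f x = 0"
  shows "rel_nn_integral P f = (\<integral>\<^sup>+x. f x \<partial>\<mu>)"
proof -
  note r = rel_rep_related[OF A P]
  have s: "sets (rel_rep P) = sets borel" "sets \<mu> = sets borel"
    using r by (auto simp: rel_measure_eq_iff[OF A])
  have *: "(\<integral>\<^sup>+x. f x \<partial>M) = (\<integral>\<^sup>+x. f x \<partial>restrict_space M (- A))" if "sets M = sets borel" for M
    using that A f
    by (subst nn_integral_restrict_space) (auto intro!: nn_integral_cong simp: indicator_def)
  show ?thesis
    unfolding rel_nn_integral_def *[OF s(1)] *[OF s(2)] restrict_space_rel_eq[OF A r] ..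
qed

lemma rel_integral_eq:
  assumes A: "A \<in> sets borel" and P: "P \<in> relative_measures A" "\<mu> \<in> P" and f: "\<And>x. x \<in> A \<Longrightarrow> f x = 0"
  shows "rel_integral P f = (LINT x|\<mu>. f x)"
proof -
  note r = rel_rep_related[OF A P]
  have s: "sets (rel_rep P) = sets borel" "sets \<mu> = sets borel"
    using r by (auto simp: rel_measure_eq_iff[OF A])
  have *: "(LINT x|M. f x) = (LINT x|restrict_space M (- A). f x)" if "sets M = sets borel" for M
    using that A f
    by (subst integral_restrict_space) (auto intro!: Bochner_Integration.integral_cong simp: indicator_def)
  show ?thesis
    unfolding rel_integral_def *[OF s(1)] *[OF s(2)] restrict_space_rel_eq[OF A r] ..
qed

lemma rel_push_eq:
  fixes p :: "'a::topological_space \<Rightarrow> 'b::topological_space"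
  assumes B: "B \<in> sets borel" and A: "A \<in> sets borel" and P: "P \<in> relative_measures B" "\<pi> \<in> P"
    and p: "p \<in> borel_measurable borel" and BA: "p ` B \<subseteq> A"
  shows "rel_push A p P = rel_measure_eq A `` {distr \<pi> borel p}"
    and "rel_push A p P \<in> relative_measures A"
proof -
  note r = rel_rep_related[OF B P]
  have s: "sets (rel_rep P) = sets borel" "sets \<pi> = sets borel"
    and e: "\<And>E. E \<in> sets borel \<Longrightarrow> E \<subseteq> - B \<Longrightarrow> emeasure (rel_rep P) E = emeasure \<pi> E"
    using r by (auto simp: rel_measure_eq_iff[OF B])
  have sp: "space (rel_rep P) = UNIV" "space \<pi> = UNIV"
    using s[THEN sets_eq_imp_space_eq] by auto
  have m: "p \<in> borel_measurable (rel_rep P)" "p \<in> borel_measurable \<pi>"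
    using p s by (auto cong: measurable_cong_sets)
  have "emeasure (distr (rel_rep P) borel p) E = emeasure (distr \<pi> borel p) E"
    if E: "E \<in> sets borel" "E \<subseteq> - A" for E
  proof -
    have "p -` E \<in> sets borel"
      using measurable_sets[OF p E(1)] by simp
    moreover have "p -` E \<subseteq> - B"
      using E(2) BA by auto
    ultimately show ?thesis
      using E(1) m e sp by (simp add: emeasure_distr)
  qed
  then have "(distr (rel_rep P) borel p, distr \<pi> borel p) \<in> rel_measure_eq A"
    by (simp add: rel_measure_eq_iff[OF A])
  then show "rel_push A p P = rel_measure_eq A `` {distr \<pi> borel p}"
    unfolding rel_push_def by (rule equiv_class_eq[OF equiv_rel_measure_eq[OF A]])
  show "rel_push A p P \<in> relative_measures A"
    unfolding rel_push_def relative_measures_def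
    by (rule quotientI) (simp add: borel_measures_def)
qed

lemma Lip_closed:
  assumes "f \<in> Lip A" "g \<in> Lip A"
  shows "(\<lambda>x. a * f x + b * g x) \<in> Lip A"
proof -
  obtain C D where "C-lipschitz_on UNIV f" "D-lipschitz_on UNIV g"
    using assms by (auto simp: Lip_def)
  then have "(\<bar>a\<bar> * C + \<bar>b\<bar> * D)-lipschitz_on UNIV (\<lambda>x. a * f x + b * g x)"
    by (intro lipschitz_on_add lipschitz_on_cmult_real)
  then show ?thesis
    using assms by (auto simp: Lip_def)
qed

lemma lip_number_least:
  assumes f: "f \<in> Lip A"
  shows "(lip_number f)-lipschitz_on UNIV f"
    and "C-lipschitz_on UNIV f \<Longrightarrow> lip_number f \<le> C"
proof -
  let ?S = "{C. C-lipschitz_on UNIV f}"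
  have ne: "?S \<noteq> {}"
    using f by (auto simp: Lip_def)
  have bdd: "bdd_below ?S"
    by (auto intro!: bdd_belowI[of _ 0] dest: lipschitz_on_nonneg)
  show "lip_number f \<le> C" if "C-lipschitz_on UNIV f"
    unfolding lip_number_def using bdd that by (auto intro: cInf_lower)
  show "(lip_number f)-lipschitz_on UNIV f"
  proof (rule lipschitz_onI)
    show "0 \<le> lip_number f"
      unfolding lip_number_def using ne by (auto intro!: cInf_greatest dest: lipschitz_on_nonneg)
    show "dist (f x) (f y) \<le> lip_number f * dist x y" for x y
    proof (cases "x = y")
      case False
      have "dist (f x) (f y) / dist x y \<le> lip_number f"
        unfolding lip_number_def using ne False
        by (intro cInf_greatest) (auto simp: divide_le_eq dest: lipschitz_onD)
      then show ?thesis
        using False by (simp add: divide_le_eq)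
    qed simp
  qed
qed

lemma Lip_bound:
  assumes "C-lipschitz_on UNIV f" "\<And>x. x \<in> A \<Longrightarrow> f x = 0" "A \<noteq> {}"
  shows "\<bar>f x\<bar> \<le> C * infdist x A"
proof (cases "C = 0")
  case True
  obtain a where "a \<in> A"
    using assms(3) by auto
  then show ?thesis
    using lipschitz_onD[OF assms(1), of x a] assms(2)[of a] True by (simp add: dist_real_def)
next
  case False
  then have C: "C > 0"
    using lipschitz_on_nonneg[OF assms(1)] by simp
  have "\<bar>f x\<bar> / C \<le> infdist x A"
    unfolding infdist_notempty[OF assms(3)]
  proof (rule cINF_greatest[OF assms(3)])
    fix a assume "a \<in> A"
    then show "\<bar>f x\<bar> / C \<le> dist x a"
      using lipschitz_onD[OF assms(1), of x a] assms(2)[of a] C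
      by (simp add: dist_real_def divide_le_eq mult.commute)
  qed
  then show ?thesis
    using C by (simp add: divide_le_eq mult.commute)
qed

lemma integrable_Lip:
  assumes A: "closed A" "A \<noteq> {}" and \<mu>: "\<mu> \<in> M1 A" and f: "f \<in> Lip A"
  shows "integrable (rel_rep \<mu>) f"
proof -
  obtain C where C: "C-lipschitz_on UNIV f"
    using f by (auto simp: Lip_def)
  have s: "sets (rel_rep \<mu>) = sets borel"
    using A \<mu> by (intro sets_rel_rep[of A]) (auto simp: M1_def)
  have "continuous_on UNIV (\<lambda>x. infdist x A)"
    by (intro continuous_intros)
  then have md: "(\<lambda>x. infdist x A) \<in> borel_measurable (rel_rep \<mu>)"
    using borel_measurable_continuous_onI s by (auto cong: measurable_cong_sets)
  have mf: "f \<in> borel_measurable (rel_rep \<mu>)"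
    using borel_measurable_continuous_onI[OF lipschitz_on_continuous_on[OF C]] s
    by (auto cong: measurable_cong_sets)
  have "integrable (rel_rep \<mu>) (\<lambda>x. infdist x A)"
    using md \<mu> by (intro integrableI_nonneg) (auto simp: M1_def rel_nn_integral_def infdist_nonneg)
  then have "integrable (rel_rep \<mu>) (\<lambda>x. C * infdist x A)"
    by simp
  then show ?thesis
    by (rule Bochner_Integration.integrable_bound[OF _ mf])
      (use Lip_bound[OF C _ A(2)] f in \<open>auto simp: Lip_def intro!: AE_I2 order.trans[OF _ abs_ge_self]\<close>)
qed

lemma diff_integral_linear:
  assumes "closed A" "A \<noteq> {}" "\<mu> \<in> M1 A" "\<nu> \<in> M1 A" "f \<in> Lip A" "g \<in> Lip A"
  shows "diff_integral \<mu> \<nu> (\<lambda>x. a * f x + b * g x) =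
    a * diff_integral \<mu> \<nu> f + b * diff_integral \<mu> \<nu> g"
  using assms by (simp add: diff_integral_def rel_integral_def integrable_Lip algebra_simps)

end

theory Submission
  imports Defs
begin

text \<open>
  Weak duality is integration of \<open>f x - f y \<le> dbar A x y\<close> against a coupling.

  For the converse, partition \<open>- A\<close> into countably many Borel pieces, each of diameter small relative
  to its distance from \<open>A\<close>. Replacing a piece by a single point then costs at most
  \<open>e \<integral> infdist x A\<close> in total, even if the measures are infinite near \<open>A\<close>. All but finitely many
  pieces carry little of this integral, and their mass may be sent to one point \<open>a\<close> of \<open>A\<close>, because
  \<open>dbar A x a = infdist x A\<close> whatever \<open>a\<close> is. What remains is a finite linear program, whose duality
  is Farkas' lemma: a finite plan is spread over the pieces by product measures, and finite potentials
  extend to functions of \<open>Lip A\<close>.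
\<close>

section \<open>Finite transport with a reservoir\<close>

text \<open>Off \<open>A\<close> the measures may have different, even infinite, total mass; what is
  finite is the integral of \<open>infdist _ A\<close>, and hence the mass at any positive distance
  from \<open>A\<close>. This dictates the scale of the partition: a piece at distance t from
  \<open>A\<close> may have size of order e t, so that moving its points costs a fraction e of
  something already integrable. The distance to \<open>A\<close> is at once the integrable weight,
  the price of the reservoir and a bound for every admissible potential. Therefore one and the same
  quantity, e times the total weight plus the weight of the omitted pieces, bounds the error made
  when a potential is sampled at the centres and the error made when a finite plan is spread out
  again. No optimal coupling is produced. As \<open>W1\<close> is an infimum, it is enough to find
  for every r > 0 a coupling whose cost exceeds a given upper bound of the dual values by at most r.
  That upper bound, enlarged by the sampling error, is the number fed into the finite
  duality.\<close>

text \<open>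
  The operation \<open>comb x t y\<close> stands for \<open>x + t y\<close>: the vectors used below are triples containing
  functions, and function types are not an instance of \<open>real_vector\<close>. The induction eliminates one
  functional \<open>a k\<close> by projecting along a vector \<open>z\<close> with \<open>a k z > 0\<close> onto its kernel.
\<close>

lemma farkas:
  fixes comb :: "'v \<Rightarrow> real \<Rightarrow> 'v \<Rightarrow> 'v" and a :: "'j \<Rightarrow> 'v \<Rightarrow> real" and b :: "'v \<Rightarrow> real"
  assumes "finite J"
    and "\<And>j x t y. j \<in> J \<Longrightarrow> a j (comb x t y) = a j x + t * a j y"
    and "\<And>x t y. b (comb x t y) = b x + t * b y"
    and "\<And>x. (\<And>j. j \<in> J \<Longrightarrow> a j x \<le> 0) \<Longrightarrow> b x \<le> 0"
  shows "\<exists>l. (\<forall>j\<in>J. 0 \<le> l j) \<and> (\<forall>x. b x = (\<Sum>j\<in>J. l j * a j x))"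
  using assms
proof (induction J arbitrary: a b rule: finite_induct)
  case empty
  \<comment> \<open>With only \<open>comb\<close> at hand, \<open>comb x (-2) x\<close> serves as
    the negative of \<open>x\<close>.\<close>
  have "b x = 0" for x
    using empty(3)[of x] empty(3)[of "comb x (-2) x"] empty(2)[of x "-2" x] by simp
  then show ?case by simp
next
  case (insert k J)
  show ?case
  proof (cases "\<forall>x. (\<forall>j\<in>J. a j x \<le> 0) \<longrightarrow> b x \<le> 0")
    case True
    then obtain l where "\<forall>j\<in>J. 0 \<le> l j" "\<forall>x. b x = (\<Sum>j\<in>J. l j * a j x)"
      using insert.IH[of a b] insert.prems(1,2) by auto
    then show ?thesis
      using insert.hyps by (intro exI[of _ "l(k := 0)"]) (auto intro!: sum.cong)
  next
    case False
    then obtain z where z: "\<forall>j\<in>J. a j z \<le> 0" "b z > 0"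
      by (auto simp: not_le)
    have kz: "a k z > 0"
      using insert.prems(3)[of z] z by (metis insertE not_le)
    let ?a = "\<lambda>j x. a j x - a k x / a k z * a j z" and ?b = "\<lambda>x. b x - a k x / a k z * b z"
    have "\<exists>l. (\<forall>j\<in>J. 0 \<le> l j) \<and> (\<forall>x. ?b x = (\<Sum>j\<in>J. l j * ?a j x))"
    proof (rule insert.IH)
      fix x assume x: "\<And>j. j \<in> J \<Longrightarrow> ?a j x \<le> 0"
      have "b (comb x (- (a k x / a k z)) z) \<le> 0"
      proof (rule insert.prems(3))
        fix j assume "j \<in> insert k J"
        then show "a j (comb x (- (a k x / a k z)) z) \<le> 0"
          using x[of j] insert.prems(1)[of j] kz by (cases "j = k") auto
      qed
      then show "?b x \<le> 0"
        using insert.prems(2) by simp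
    qed (use insert.prems(1,2) kz in \<open>simp_all add: field_simps\<close>)
    then obtain l where l: "\<forall>j\<in>J. 0 \<le> l j" "\<And>x. ?b x = (\<Sum>j\<in>J. l j * ?a j x)"
      by auto
    \<comment> \<open>This weight is forced: it is the only one for which the desired identity holds
      at \<open>z\<close>. It is nonnegative because \<open>z\<close> satisfies the constraints in
      \<open>J\<close> and yet \<open>b z > 0\<close>.\<close>
    define w where "w = (b z - (\<Sum>j\<in>J. l j * a j z)) / a k z"
    have "(\<Sum>j\<in>J. l j * a j z) \<le> 0"
      using l(1) z(1) by (intro sum_nonpos) (simp add: mult_nonneg_nonpos)
    then have "w \<ge> 0"
      using z(2) kz by (simp add: w_def)
    moreover have "b x = w * a k x + (\<Sum>j\<in>J. l j * a j x)" for x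
    proof -
      have "b x = a k x / a k z * b z + (\<Sum>j\<in>J. l j * a j x - a k x / a k z * (l j * a j z))"
        using l(2)[of x] by (simp add: algebra_simps)
      also have "\<dots> = a k x / a k z * b z +
          ((\<Sum>j\<in>J. l j * a j x) - a k x / a k z * (\<Sum>j\<in>J. l j * a j z))"
        by (simp only: sum_subtractf sum_distrib_left)
      finally show ?thesis
        using kz unfolding w_def by (simp add: field_simps)
    qed
    moreover have "(\<Sum>j\<in>J. (l(k := w)) j * a j x) = (\<Sum>j\<in>J. l j * a j x)" for x
      using insert.hyps by (intro sum.cong) auto
    ultimately show ?thesis
      using l(1) insert.hyps by (intro exI[of _ "l(k := w)"]) auto
  qed
qed

text \<open>
  The slacks \<open>u\<close> and \<open>v\<close> are the masses exchanged with \<open>A\<close>, at cost \<open>d\<close>. In the proof the index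
  \<open>None\<close> plays the role of \<open>A\<close>, and the coordinate \<open>t\<close> homogenises the constraints.
\<close>

lemma partial_transport_duality:
  fixes c :: "'i \<Rightarrow> 'i \<Rightarrow> real" and d m n :: "'i \<Rightarrow> real"
  assumes I: "finite I" and mn: "\<And>i. i \<in> I \<Longrightarrow> 0 \<le> m i" "\<And>i. i \<in> I \<Longrightarrow> 0 \<le> n i"
    and D: "\<And>f g. (\<And>i j. i \<in> I \<Longrightarrow> j \<in> I \<Longrightarrow> f i - g j \<le> c i j) \<Longrightarrow> (\<And>i. i \<in> I \<Longrightarrow> f i \<le> d i) \<Longrightarrow>
      (\<And>i. i \<in> I \<Longrightarrow> - g i \<le> d i) \<Longrightarrow> (\<Sum>i\<in>I. m i * f i) - (\<Sum>i\<in>I. n i * g i) \<le> D"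
  obtains l u v where
    "\<And>i j. i \<in> I \<Longrightarrow> j \<in> I \<Longrightarrow> 0 \<le> l i j" "\<And>i. i \<in> I \<Longrightarrow> 0 \<le> u i" "\<And>i. i \<in> I \<Longrightarrow> 0 \<le> v i"
    "\<And>i. i \<in> I \<Longrightarrow> (\<Sum>j\<in>I. l i j) + u i = m i" "\<And>j. j \<in> I \<Longrightarrow> (\<Sum>i\<in>I. l i j) + v j = n j"
    "(\<Sum>i\<in>I. \<Sum>j\<in>I. l i j * c i j) + (\<Sum>i\<in>I. u i * d i) + (\<Sum>i\<in>I. v i * d i) \<le> D"
proof -
  define a :: "'i option \<times> 'i option \<Rightarrow> ('i \<Rightarrow> real) \<times> ('i \<Rightarrow> real) \<times> real \<Rightarrow> real" where
    "a = (\<lambda>(p, q) (f, g, t). case p of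
        None \<Rightarrow> (case q of None \<Rightarrow> - t | Some j \<Rightarrow> - g j - d j * t)
      | Some i \<Rightarrow> (case q of None \<Rightarrow> f i - d i * t | Some j \<Rightarrow> f i - g j - c i j * t))"
  define b :: "('i \<Rightarrow> real) \<times> ('i \<Rightarrow> real) \<times> real \<Rightarrow> real" where
    "b = (\<lambda>(f, g, t). (\<Sum>i\<in>I. m i * f i) - (\<Sum>i\<in>I. n i * g i) - D * t)"
  define comb :: "('i \<Rightarrow> real) \<times> ('i \<Rightarrow> real) \<times> real \<Rightarrow> real \<Rightarrow> ('i \<Rightarrow> real) \<times> ('i \<Rightarrow> real) \<times> real \<Rightarrow>
      ('i \<Rightarrow> real) \<times> ('i \<Rightarrow> real) \<times> real" where
    "comb = (\<lambda>(f, g, t) s (f', g', t'). (\<lambda>i. f i + s * f' i, \<lambda>i. g i + s * g' i, t + s * t'))"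
  let ?O = "insert None (Some ` I)"
  have "\<exists>l. (\<forall>j\<in>?O \<times> ?O. 0 \<le> l j) \<and> (\<forall>x. b x = (\<Sum>j\<in>?O \<times> ?O. l j * a j x))"
  proof (rule farkas[where comb = comb])
    show "finite (?O \<times> ?O)" using I by simp
    show "a j (comb x t y) = a j x + t * a j y" for j x t y
      by (cases j; cases x; cases y) (auto simp: a_def comb_def algebra_simps split: option.splits)
    show "b (comb x t y) = b x + t * b y" for x t y
      by (cases x; cases y) (simp add: b_def comb_def algebra_simps sum.distrib sum_distrib_left)
    fix x :: "('i \<Rightarrow> real) \<times> ('i \<Rightarrow> real) \<times> real"
    obtain f g t where x: "x = (f, g, t)" by (cases x)
    assume le: "\<And>j. j \<in> ?O \<times> ?O \<Longrightarrow> a j x \<le> 0"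
    \<comment> \<open>The functional at \<open>(None, None)\<close> is there only to express this
      sign condition.\<close>
    have t: "t \<ge> 0" using le[of "(None, None)"] by (simp add: a_def x)
    have f: "f i \<le> d i * t" if "i \<in> I" for i
      using le[of "(Some i, None)"] that by (simp add: a_def x)
    have g: "- g i \<le> d i * t" if "i \<in> I" for i
      using le[of "(None, Some i)"] that by (simp add: a_def x)
    have fg: "f i - g j \<le> c i j * t" if "i \<in> I" "j \<in> I" for i j
      using le[of "(Some i, Some j)"] that by (simp add: a_def x)
    show "b x \<le> 0"
    \<comment> \<open>For t > 0 the constraints rescale to those of \<open>D\<close>. For t = 0 they
      are recession directions, where \<open>f \<le> 0 \<le> g\<close> on \<open>I\<close> and the
      signs of \<open>m\<close> and \<open>n\<close> decide.\<close>
    proof (cases "t = 0")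
      case True
      have "(\<Sum>i\<in>I. m i * f i) \<le> 0" "(\<Sum>i\<in>I. n i * g i) \<ge> 0"
        using f g mn True by (auto intro!: sum_nonpos sum_nonneg simp: mult_nonneg_nonpos)
      then show ?thesis by (simp add: b_def x True)
    next
      case False
      with t have t: "t > 0" by simp
      have "(\<Sum>i\<in>I. m i * (f i / t)) - (\<Sum>i\<in>I. n i * (g i / t)) \<le> D"
        using t f g fg by (intro D) (auto simp: divide_le_eq minus_le_iff le_divide_eq diff_divide_distrib[symmetric]
          simp flip: minus_divide_left)
      then show ?thesis
        using t by (simp add: b_def x sum_divide_distrib[symmetric] diff_divide_distrib[symmetric] divide_le_eq)
    qed
  qed
  then obtain l where l: "\<And>j. j \<in> ?O \<times> ?O \<Longrightarrow> 0 \<le> l j" and bl: "\<And>x. b x = (\<Sum>j\<in>?O \<times> ?O. l j * a j x)"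
    by auto
  have bl': "b x = (\<Sum>i\<in>I. \<Sum>j\<in>I. l (Some i, Some j) * a (Some i, Some j) x)
     + (\<Sum>i\<in>I. l (Some i, None) * a (Some i, None) x) + (\<Sum>i\<in>I. l (None, Some i) * a (None, Some i) x)
     + l (None, None) * a (None, None) x" for x
  proof -
    have "b x = (\<Sum>p\<in>?O. \<Sum>q\<in>?O. l (p, q) * a (p, q) x)"
      unfolding bl by (simp only: sum.cartesian_product split_def prod.collapse)
    then show ?thesis
      using I by (simp add: sum.reindex sum.distrib image_iff)
  qed
  show ?thesis
  \<comment> \<open>The Farkas multipliers are the plan. The identity for \<open>b\<close> holds for
    all (f, g, t), so unit vectors in f and g read off the marginals and t = 1 reads off the
    cost.\<close>
  proof (rule that[of "\<lambda>i j. l (Some i, Some j)" "\<lambda>i. l (Some i, None)" "\<lambda>i. l (None, Some i)"])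
    show "0 \<le> l (Some i, Some j)" if "i \<in> I" "j \<in> I" for i j
      using l that by simp
    show "0 \<le> l (Some i, None)" "0 \<le> l (None, Some i)" if "i \<in> I" for i
      using l that by simp_all
    show "(\<Sum>j\<in>I. l (Some i, Some j)) + l (Some i, None) = m i" if "i \<in> I" for i
    proof -
      let ?f = "\<lambda>k. if k = i then 1 else 0 :: real"
      have "(\<Sum>k\<in>I. \<Sum>j\<in>I. l (Some k, Some j) * ?f k) = (\<Sum>k\<in>I. (\<Sum>j\<in>I. l (Some k, Some j)) * ?f k)"
        by (simp only: sum_distrib_right)
      then have "(\<Sum>k\<in>I. m k * ?f k) = (\<Sum>k\<in>I. (\<Sum>j\<in>I. l (Some k, Some j)) * ?f k) +
          (\<Sum>k\<in>I. l (Some k, None) * ?f k)"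
        using bl'[of "(?f, \<lambda>_. 0, 0)"] by (simp add: a_def b_def)
      then show ?thesis
        using that I by (simp add: if_distrib[of "\<lambda>z. _ * z"] cong: if_cong)
    qed
    show "(\<Sum>i\<in>I. l (Some i, Some j)) + l (None, Some j) = n j" if "j \<in> I" for j
      using bl'[of "(\<lambda>_. 0, indicator {j}, 0)"] that I
      by (simp add: a_def b_def indicator_def sum_negf if_distrib[of "\<lambda>z. _ * z"] if_distrib[of uminus] sum.delta' cong: if_cong)
    show "(\<Sum>i\<in>I. \<Sum>j\<in>I. l (Some i, Some j) * c i j) + (\<Sum>i\<in>I. l (Some i, None) * d i) +
      (\<Sum>i\<in>I. l (None, Some i) * d i) \<le> D"
      \<comment> \<open>The cost and \<open>D\<close> differ by the multiplier of t \<ge> 0, whence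
        an inequality.\<close>
      using bl'[of "(\<lambda>_. 0, \<lambda>_. 0, 1)"] l[of "(None, None)"]
      by (simp add: a_def b_def sum_negf)
  qed
qed

section \<open>Sums of measures and Whitney partitions\<close>

text \<open>Needed because the final plan is a sum of three measures. The sigma-algebra is taken
  from \<open>M\<close>, so the notion is meaningful when \<open>sets M = sets N\<close>, as the
  lemmas on its values assume.\<close>

definition add_measure :: "'a measure \<Rightarrow> 'a measure \<Rightarrow> 'a measure" where
  "add_measure M N = measure_of (space M) (sets M) (\<lambda>E. emeasure M E + emeasure N E)"

lemma space_add_measure [simp]: "space (add_measure M N) = space M"
  and sets_add_measure [simp, measurable_cong]: "sets (add_measure M N) = sets M"
  by (simp_all add: add_measure_def sets.space_closed sets.sigma_sets_eq)

lemma emeasure_add_measure: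
  assumes "sets M = sets N" "E \<in> sets M"
  shows "emeasure (add_measure M N) E = emeasure M E + emeasure N E"
proof (rule emeasure_measure_of[OF add_measure_def sets.space_closed])
  show "positive (sets (add_measure M N)) (\<lambda>E. emeasure M E + emeasure N E)"
    by (simp add: positive_def)
  show "countably_additive (sets (add_measure M N)) (\<lambda>E. emeasure M E + emeasure N E)"
    using assms(1) by (auto simp: countably_additive_def suminf_add[symmetric] suminf_emeasure)
qed (use assms in simp)

lemma nn_integral_add_measure:
  assumes s: "sets M = sets N" and f: "f \<in> borel_measurable M"
  shows "(\<integral>\<^sup>+x. f x \<partial>add_measure M N) = (\<integral>\<^sup>+x. f x \<partial>M) + (\<integral>\<^sup>+x. f x \<partial>N)"
  using f
proof (induction rule: borel_measurable_induct)
  case (cong f g)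
  then show ?case
    using sets_eq_imp_space_eq[OF s] by (simp cong: nn_integral_cong_simp)
next
  case (set A)
  then show ?case
    using s by (simp add: emeasure_add_measure)
next
  case (mult u c)
  moreover have "u \<in> borel_measurable N"
    using mult s by (simp cong: measurable_cong_sets)
  ultimately show ?case
    by (simp add: nn_integral_cmult distrib_left)
next
  case (add u v)
  moreover have "u \<in> borel_measurable N" "v \<in> borel_measurable N"
    using add s by (simp_all cong: measurable_cong_sets)
  ultimately show ?case
    by (simp add: nn_integral_add ac_simps)
next
  case (seq U)
  have m: "U i \<in> borel_measurable M" "U i \<in> borel_measurable N" "U i \<in> borel_measurable (add_measure M N)" for i
    using seq s by (simp_all cong: measurable_cong_sets)
  have i: "incseq (\<lambda>i. integral\<^sup>N M (U i))" "incseq (\<lambda>i. integral\<^sup>N N (U i))"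
    using seq(3) by (auto simp: incseq_def le_fun_def intro!: nn_integral_mono)
  have "(\<integral>\<^sup>+x. (SUP i. U i) x \<partial>add_measure M N) = (SUP i. integral\<^sup>N (add_measure M N) (U i))"
    unfolding SUP_apply using seq(3) m by (intro nn_integral_monotone_convergence_SUP)
  also have "\<dots> = (SUP i. integral\<^sup>N M (U i)) + (SUP i. integral\<^sup>N N (U i))"
    using seq.IH i by (simp add: ennreal_SUP_add)
  also have "\<dots> = (\<integral>\<^sup>+x. (SUP i. U i) x \<partial>M) + (\<integral>\<^sup>+x. (SUP i. U i) x \<partial>N)"
    unfolding SUP_apply using seq(3) m by (simp add: nn_integral_monotone_convergence_SUP)
  finally show ?case .
qed

section \<open>The relative cost \<open>dbar\<close>\<close>

lemma dbar_lipschitz: "dbar A x y \<le> dbar A x' y' + dist x x' + dist y y'"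
proof -
  have "dist x y \<le> dist x' y' + dist x x' + dist y y'"
    by metric
  then show ?thesis
    using infdist_triangle[of x A x'] infdist_triangle[of y A y'] by (simp add: dbar_def)
qed

lemma dbar_nonneg: "0 \<le> dbar A x y"
  by (simp add: dbar_def infdist_nonneg)

lemma dbar_self [simp]: "dbar A x x = 0"
  by (simp add: dbar_def infdist_nonneg)

lemma dbar_commute: "dbar A x y = dbar A y x"
  by (simp add: dbar_def dist_commute add.commute)

lemma dbar_right: "a \<in> A \<Longrightarrow> dbar A x a = infdist x A"
  using infdist_le[of a A x] by (simp add: dbar_def)

lemma dbar_left: "a \<in> A \<Longrightarrow> dbar A a x = infdist x A"
  by (metis dbar_commute dbar_right)

lemma dbar_measurable [measurable]:
  "(\<lambda>z. dbar A (fst z) (snd z)) \<in> borel_measurable (borel :: ('a::metric_space \<times> 'a) measure)"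
  unfolding dbar_def by (intro borel_measurable_continuous_onI continuous_intros)

text \<open>Around each point of a countable dense sequence take the open set of those y that are
  closer to it than \<open>e * infdist y A\<close>; these sets cover the complement of
  \<open>A\<close> and are made disjoint. The radius depends on the moving point y rather than on
  the centre, so the error can be integrated directly. The last property gives the pieces finite
  mass.\<close>

lemma Whitney_partition:
  fixes A :: "'a::{metric_space, second_countable_topology} set"
  assumes A: "closed A" "A \<noteq> {}" and e: "0 < e" "e < 1"
  obtains U :: "nat \<Rightarrow> 'a set" and x where
    "\<And>i. U i \<in> sets borel" "disjoint_family U" "(\<Union>i. U i) = - A"
    "\<And>i y. y \<in> U i \<Longrightarrow> dist y (x i) \<le> e * infdist y A"
    "\<And>i. \<exists>r>0. \<forall>y\<in>U i. r \<le> infdist y A"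
proof -
  obtain D :: "'a set" where D: "countable D" "\<And>X. open X \<Longrightarrow> X \<noteq> {} \<Longrightarrow> \<exists>d\<in>D. d \<in> X"
    using countable_dense_exists by blast
  have "D \<noteq> {}"
    using D(2)[of UNIV] by auto
  define x where "x = from_nat_into D"
  define V where "V = (\<lambda>i. {y. dist y (x i) < e * infdist y A})"
  have "open (V i)" for i
    unfolding V_def by (intro open_Collect_less continuous_intros)
  then have Vb: "V i \<in> sets borel" for i
    by simp
  have pos: "0 < infdist y A" if "y \<in> V i" for y i
  proof -
    have "0 < e * infdist y A"
      using that zero_le_dist[of y "x i"] unfolding V_def mem_Collect_eq by linarith
    then show ?thesis
      using e by (simp add: zero_less_mult_iff)
  qed
  show thesis
  proof
    show "disjointed V i \<in> sets borel" for i
      using Vb sets.range_disjointed_sets[of V borel] by auto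
    show "disjoint_family (disjointed V)"
      by (rule disjoint_family_disjointed)
    show "(\<Union>i. disjointed V i) = - A"
    proof -
      have "y \<in> (\<Union>i. V i)" if "y \<notin> A" for y
      proof -
        have "0 < e * infdist y A"
          using e that A by (simp add: infdist_pos_not_in_closed)
        then obtain d where "d \<in> D" "d \<in> ball y (e * infdist y A)"
          using D(2)[of "ball y (e * infdist y A)"] by auto
        moreover obtain i where "x i = d"
          using from_nat_into_surj[OF D(1) \<open>d \<in> D\<close>] by (auto simp: x_def)
        ultimately show ?thesis
          by (auto simp: V_def)
      qed
      moreover have "y \<notin> A" if "y \<in> V i" for y i
        using pos[OF that] by auto
      ultimately show ?thesis
        unfolding UN_disjointed_eq by auto
    qed
    show "dist y (x i) \<le> e * infdist y A" if "y \<in> disjointed V i" for i y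
      using that disjointed_subset[of V i] by (auto simp: V_def)
    show "\<exists>r>0. \<forall>y\<in>disjointed V i. r \<le> infdist y A" for i
    proof (cases "disjointed V i = {}")
      case False
      have le: "dist y (x i) < e * infdist y A" if "y \<in> disjointed V i" for y
        using that disjointed_subset[of V i] by (auto simp: V_def)
      obtain y where y: "y \<in> disjointed V i"
        using False by auto
      \<comment> \<open>Here \<open>e < 1\<close> matters: the centre of a nonempty piece cannot lie
        in \<open>A\<close>.\<close>
      have "(1 - e) * infdist y A > 0"
        using pos[of y i] y disjointed_subset[of V i] e by auto
      then have "infdist (x i) A > 0"
        using le[OF y] infdist_triangle[of y A "x i"] by (simp add: algebra_simps)
      \<comment> \<open>The 2 bounds 1 + e: the centre is at most e times \<open>infdist z A\<close>
        away from z.\<close>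
      moreover have "infdist (x i) A / 2 \<le> infdist z A" if "z \<in> disjointed V i" for z
        using le[OF that] infdist_triangle[of "x i" A z] e infdist_nonneg[of z A]
          mult_right_mono[of e 1 "infdist z A"] by (simp add: dist_commute)
      ultimately show ?thesis
        by (intro exI[of _ "infdist (x i) A / 2"]) auto
    qed (auto intro: exI[of _ 1])
  qed
qed

section \<open>Plans built from finite ones\<close>

text \<open>Such weights are the densities of the mass exchanged with \<open>A\<close>: everything
  on the residual set \<open>S\<close>, and the fraction \<open>r i\<close> of each piece
  \<open>U i\<close>.\<close>

lemma nn_integral_restricted_step:
  fixes M :: "'a measure"
  assumes "finite I" "\<And>i. i \<in> I \<Longrightarrow> U i \<in> sets M" "S \<in> sets M" "f \<in> borel_measurable M"
  shows "(\<integral>\<^sup>+x. (indicator S x + (\<Sum>i\<in>I. r i * indicator (U i) x)) * f x \<partial>M) =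
    (\<integral>\<^sup>+x. indicator S x * f x \<partial>M) + (\<Sum>i\<in>I. r i * (\<integral>\<^sup>+x. indicator (U i) x * f x \<partial>M))"
proof -
  have [measurable]: "f \<in> borel_measurable M" "S \<in> sets M" "i \<in> I \<Longrightarrow> U i \<in> sets M" for i
    using assms by auto
  have "(\<integral>\<^sup>+x. (indicator S x + (\<Sum>i\<in>I. r i * indicator (U i) x)) * f x \<partial>M) =
      (\<integral>\<^sup>+x. indicator S x * f x + (\<Sum>i\<in>I. r i * (indicator (U i) x * f x)) \<partial>M)"
    by (simp add: distrib_right sum_distrib_right mult.assoc)
  then show ?thesis
    by (simp add: nn_integral_add nn_integral_sum nn_integral_cmult)
qed

text \<open>The previous lemma with all fractions equal to 1. The integrand may be nonzero only on
  the pieces, so mass on \<open>A\<close> does not disturb the decomposition.\<close>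

lemma nn_integral_partition:
  fixes M :: "'a measure"
  assumes "finite I" "\<And>i. i \<in> I \<Longrightarrow> U i \<in> sets M" "S \<in> sets M" "f \<in> borel_measurable M"
    and d: "disjoint_family_on U I" and S: "S \<inter> (\<Union>i\<in>I. U i) = {}"
    and f: "\<And>x. x \<in> space M \<Longrightarrow> x \<notin> S \<union> (\<Union>i\<in>I. U i) \<Longrightarrow> f x = 0"
  shows "(\<integral>\<^sup>+x. f x \<partial>M) = (\<integral>\<^sup>+x. indicator S x * f x \<partial>M) + (\<Sum>i\<in>I. \<integral>\<^sup>+x. indicator (U i) x * f x \<partial>M)"
proof -
  have "(indicator S x + (\<Sum>i\<in>I. 1 * indicator (U i) x)) * f x = f x" if "x \<in> space M" for x
  proof -
    have "(\<Sum>i\<in>I. 1 * indicator (U i) x) = (indicator (\<Union>i\<in>I. U i) x :: ennreal)"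
      by (simp only: mult_1 indicator_UN_disjoint[OF assms(1) d])
    then show ?thesis
      using f[OF that] S by (simp only:) (auto simp: indicator_def)
  qed
  then show ?thesis
    using nn_integral_restricted_step[of I U M S f "\<lambda>_. 1"] assms(1-4) by (simp cong: nn_integral_cong)
qed

lemma borel_pair_measure_sets:
  fixes M N :: "'a::second_countable_topology measure"
  assumes "sets M = sets borel" "sets N = sets borel"
  shows "sets (M \<Otimes>\<^sub>M N) = sets borel"
  unfolding borel_prod[symmetric] by (rule sets_pair_measure_cong[OF assms])

text \<open>
  The sum of the measures \<open>L i j \<cdot> (M|U i \<otimes> N|U j)\<close>, written as one density. The factors are restricted
  to the union of the blocks because \<open>M\<close> and \<open>N\<close> need not be \<open>\<sigma>\<close>-finite on \<open>A\<close>, so Fubini is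
  not available for them.
\<close>

definition block_plan ::
    "'i set \<Rightarrow> ('i \<Rightarrow> 'a set) \<Rightarrow> ('i \<Rightarrow> 'i \<Rightarrow> ennreal) \<Rightarrow> 'a measure \<Rightarrow> 'a measure \<Rightarrow> ('a \<times> 'a) measure" where
  "block_plan I U L M N =
     density (density M (indicator (\<Union>i\<in>I. U i)) \<Otimes>\<^sub>M density N (indicator (\<Union>i\<in>I. U i)))
       (\<lambda>(x, y). \<Sum>i\<in>I. \<Sum>j\<in>I. L i j * (indicator (U i) x * indicator (U j) y))"

text \<open>Both orders of integration are kept: for the first marginal the inner integral over
  \<open>N\<close> should factor out, for the second the one over \<open>M\<close>.\<close>

lemma
  fixes M N :: "'a::second_countable_topology measure"
  assumes s: "sets M = sets borel" "sets N = sets borel"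
    and I: "finite I" and U: "\<And>i. i \<in> I \<Longrightarrow> U i \<in> sets borel"
    and fin: "\<And>i. i \<in> I \<Longrightarrow> emeasure M (U i) < \<infinity>" "\<And>i. i \<in> I \<Longrightarrow> emeasure N (U i) < \<infinity>"
  shows sets_block_plan: "sets (block_plan I U L M N) = sets borel"
    and nn_integral_block_plan_fst: "k \<in> borel_measurable borel \<Longrightarrow> (\<integral>\<^sup>+z. k z \<partial>block_plan I U L M N) =
      (\<Sum>i\<in>I. \<Sum>j\<in>I. L i j * (\<integral>\<^sup>+x. indicator (U i) x * (\<integral>\<^sup>+y. indicator (U j) y * k (x, y) \<partial>N) \<partial>M))"
    and nn_integral_block_plan_snd: "k \<in> borel_measurable borel \<Longrightarrow> (\<integral>\<^sup>+z. k z \<partial>block_plan I U L M N) =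
      (\<Sum>i\<in>I. \<Sum>j\<in>I. L i j * (\<integral>\<^sup>+y. indicator (U j) y * (\<integral>\<^sup>+x. indicator (U i) x * k (x, y) \<partial>M) \<partial>N))"
proof -
  let ?V = "\<Union>i\<in>I. U i"
  define M' N' where "M' = density M (indicator ?V)" and "N' = density N (indicator ?V)"
  have V: "?V \<in> sets borel"
    using I U by auto
  have s': "sets M' = sets borel" "sets N' = sets borel"
    by (simp_all add: M'_def N'_def s)
  note sp = sets_pair_measure_cong[OF s'(1) s'(2)] borel_pair_measure_sets[OF s']
  \<comment> \<open>Once Fubini has been applied to the restricted factors, which are finite, this
    removes the restriction again.\<close>
  have restr: "(\<integral>\<^sup>+x. indicator (U i) x * f x \<partial>density Q (indicator ?V)) = (\<integral>\<^sup>+x. indicator (U i) x * f x \<partial>Q)"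
    if "sets Q = sets borel" "i \<in> I" "f \<in> borel_measurable borel" for Q i and f :: "'a \<Rightarrow> ennreal"
  proof -
    have [measurable]: "f \<in> borel_measurable Q" "U i \<in> sets Q" "?V \<in> sets Q"
      using that U V by (simp_all cong: measurable_cong_sets)
    have "(\<integral>\<^sup>+x. indicator (U i) x * f x \<partial>density Q (indicator ?V)) =
        (\<integral>\<^sup>+x. indicator ?V x * (indicator (U i) x * f x) \<partial>Q)"
      by (subst nn_integral_density) auto
    also have "\<dots> = (\<integral>\<^sup>+x. indicator (U i) x * f x \<partial>Q)"
      using that(2) by (intro nn_integral_cong) (auto simp: indicator_def)
    finally show ?thesis .
  qed
  have fin': "finite_measure (density Q (indicator ?V))"
    if "sets Q = sets borel" "\<And>i. i \<in> I \<Longrightarrow> emeasure Q (U i) < \<infinity>" for Q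
  proof
    have "emeasure Q ?V \<le> (\<Sum>i\<in>I. emeasure Q (U i))"
      using I U that(1) by (intro emeasure_subadditive_finite) auto
    also have "\<dots> < \<infinity>"
      using that(2) I by (simp add: less_top)
    finally have "emeasure Q ?V < \<infinity>" .
    moreover have "emeasure (density Q (indicator ?V)) (space Q) = emeasure Q ?V"
      using V that(1) sets.sets_into_space[of ?V Q]
      by (subst emeasure_density) (auto simp: Int_absorb2 sets_eq_imp_space_eq simp flip: indicator_inter_arith)
    ultimately show "emeasure (density Q (indicator ?V)) (space (density Q (indicator ?V))) \<noteq> \<infinity>"
      by simp
  qed
  interpret M': finite_measure M' unfolding M'_def by (rule fin'[OF s(1) fin(1)])
  interpret N': finite_measure N' unfolding N'_def by (rule fin'[OF s(2) fin(2)])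
  interpret P: pair_sigma_finite M' N' ..
  have Um [measurable]: "U i \<in> sets M'" "U i \<in> sets N'" if "i \<in> I" for i
    using U that s' by auto
  show "sets (block_plan I U L M N) = sets borel"
    using sp(2) by (simp add: block_plan_def M'_def N'_def)
  assume k: "k \<in> borel_measurable borel"
  then have k' [measurable]: "k \<in> borel_measurable (M' \<Otimes>\<^sub>M N')"
    using sp(2) by (simp cong: measurable_cong_sets)
  have kx: "(\<lambda>y. k (x, y)) \<in> borel_measurable borel" "(\<lambda>x. k (x, y)) \<in> borel_measurable borel" for x y
    using k by (auto intro!: measurable_compose[OF _ k] borel_measurable_Pair)
  have eq: "(\<integral>\<^sup>+z. k z \<partial>block_plan I U L M N) =
      (\<Sum>i\<in>I. \<Sum>j\<in>I. L i j * (\<integral>\<^sup>+z. indicator (U i) (fst z) * indicator (U j) (snd z) * k z \<partial>(M' \<Otimes>\<^sub>M N')))"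
  proof -
    have "(\<integral>\<^sup>+z. k z \<partial>block_plan I U L M N) = (\<integral>\<^sup>+z. (\<Sum>i\<in>I. \<Sum>j\<in>I. 
        L i j * (indicator (U i) (fst z) * indicator (U j) (snd z))) * k z \<partial>(M' \<Otimes>\<^sub>M N'))"
      unfolding block_plan_def M'_def[symmetric] N'_def[symmetric]
      by (subst nn_integral_density) (auto simp: split_def)
    also have "\<dots> = (\<integral>\<^sup>+z. (\<Sum>i\<in>I. \<Sum>j\<in>I. 
        L i j * (indicator (U i) (fst z) * indicator (U j) (snd z) * k z)) \<partial>(M' \<Otimes>\<^sub>M N'))"
      by (simp add: sum_distrib_right mult.assoc)
    also have "\<dots> = (\<Sum>i\<in>I. \<Sum>j\<in>I. L i j * (\<integral>\<^sup>+z. indicator (U i) (fst z) * indicator (U j) (snd z) * k z \<partial>(M' \<Otimes>\<^sub>M N')))"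
      by (simp add: nn_integral_sum nn_integral_cmult)
    finally show ?thesis .
  qed
  have fst: "(\<integral>\<^sup>+z. indicator (U i) (fst z) * indicator (U j) (snd z) * k z \<partial>(M' \<Otimes>\<^sub>M N')) =
      (\<integral>\<^sup>+x. indicator (U i) x * (\<integral>\<^sup>+y. indicator (U j) y * k (x, y) \<partial>N) \<partial>M)" if ij: "i \<in> I" "j \<in> I" for i j
  proof -
    have [measurable]: "U i \<in> sets M'" "U j \<in> sets N'"
      using Um ij by auto
    have m: "(\<lambda>x. \<integral>\<^sup>+y. indicator (U j) y * k (x, y) \<partial>N') \<in> borel_measurable M'"
      by measurable
    have "(\<integral>\<^sup>+z. indicator (U i) (fst z) * indicator (U j) (snd z) * k z \<partial>(M' \<Otimes>\<^sub>M N')) =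
        (\<integral>\<^sup>+x. \<integral>\<^sup>+y. indicator (U i) x * (indicator (U j) y * k (x, y)) \<partial>N' \<partial>M')"
      by (subst N'.nn_integral_fst[symmetric]) (simp_all add: mult.assoc)
    also have "\<dots> = (\<integral>\<^sup>+x. indicator (U i) x * (\<integral>\<^sup>+y. indicator (U j) y * k (x, y) \<partial>N') \<partial>M')"
      by (intro nn_integral_cong nn_integral_cmult) measurable
    also have "\<dots> = (\<integral>\<^sup>+x. indicator (U i) x * (\<integral>\<^sup>+y. indicator (U j) y * k (x, y) \<partial>N') \<partial>M)"
      using m s' unfolding M'_def by (intro restr s ij) (simp cong: measurable_cong_sets add: s)
    also have "\<dots> = (\<integral>\<^sup>+x. indicator (U i) x * (\<integral>\<^sup>+y. indicator (U j) y * k (x, y) \<partial>N) \<partial>M)"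
      unfolding N'_def by (simp add: restr[OF s(2) ij(2) kx(1)])
    finally show ?thesis .
  qed
  have snd: "(\<integral>\<^sup>+z. indicator (U i) (fst z) * indicator (U j) (snd z) * k z \<partial>(M' \<Otimes>\<^sub>M N')) =
      (\<integral>\<^sup>+y. indicator (U j) y * (\<integral>\<^sup>+x. indicator (U i) x * k (x, y) \<partial>M) \<partial>N)" if ij: "i \<in> I" "j \<in> I" for i j
  proof -
    have [measurable]: "U i \<in> sets M'" "U j \<in> sets N'"
      using Um ij by auto
    have m: "(\<lambda>y. \<integral>\<^sup>+x. indicator (U i) x * k (x, y) \<partial>M') \<in> borel_measurable N'"
      by measurable
    have "(\<integral>\<^sup>+z. indicator (U i) (fst z) * indicator (U j) (snd z) * k z \<partial>(M' \<Otimes>\<^sub>M N')) =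
        (\<integral>\<^sup>+y. \<integral>\<^sup>+x. indicator (U j) y * (indicator (U i) x * k (x, y)) \<partial>M' \<partial>N')"
      by (subst P.nn_integral_snd[symmetric]) (simp_all add: mult_ac)
    also have "\<dots> = (\<integral>\<^sup>+y. indicator (U j) y * (\<integral>\<^sup>+x. indicator (U i) x * k (x, y) \<partial>M') \<partial>N')"
      by (intro nn_integral_cong nn_integral_cmult) measurable
    also have "\<dots> = (\<integral>\<^sup>+y. indicator (U j) y * (\<integral>\<^sup>+x. indicator (U i) x * k (x, y) \<partial>M') \<partial>N)"
      using m s' unfolding N'_def by (intro restr s ij) (simp cong: measurable_cong_sets add: s)
    also have "\<dots> = (\<integral>\<^sup>+y. indicator (U j) y * (\<integral>\<^sup>+x. indicator (U i) x * k (x, y) \<partial>M) \<partial>N)"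
      unfolding M'_def by (simp add: restr[OF s(1) ij(1) kx(2)])
    finally show ?thesis .
  qed
  show "(\<integral>\<^sup>+z. k z \<partial>block_plan I U L M N) =
      (\<Sum>i\<in>I. \<Sum>j\<in>I. L i j * (\<integral>\<^sup>+x. indicator (U i) x * (\<integral>\<^sup>+y. indicator (U j) y * k (x, y) \<partial>N) \<partial>M))"
    unfolding eq using fst by (intro sum.cong refl) simp
  show "(\<integral>\<^sup>+z. k z \<partial>block_plan I U L M N) =
      (\<Sum>i\<in>I. \<Sum>j\<in>I. L i j * (\<integral>\<^sup>+y. indicator (U j) y * (\<integral>\<^sup>+x. indicator (U i) x * k (x, y) \<partial>M) \<partial>N))"
    unfolding eq using snd by (intro sum.cong refl) simp
qed

text \<open>Since \<open>dbar A\<close> is 1-Lipschitz in each variable, on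
  \<open>U \<times> V\<close> it exceeds its value at the centres by at most
  \<open>e * infdist s A + e * infdist t A\<close>. Integrating this bound gives the three
  terms.\<close>

lemma nn_integral_block_cost:
  fixes M N :: "'a::{metric_space,second_countable_topology} measure"
  assumes s: "sets M = sets borel" "sets N = sets borel"
    and U: "U \<in> sets borel" "V \<in> sets borel"
    and mn: "emeasure M U = m" "emeasure N V = n"
    and e: "0 \<le> e" and near: "\<And>z. z \<in> U \<Longrightarrow> dist z x \<le> e * infdist z A" "\<And>z. z \<in> V \<Longrightarrow> dist z y \<le> e * infdist z A"
  shows "(\<integral>\<^sup>+s. indicator U s * (\<integral>\<^sup>+t. indicator V t * ennreal (dbar A s t) \<partial>N) \<partial>M) \<le>
    ennreal (dbar A x y) * m * n + ennreal e * (\<integral>\<^sup>+s. indicator U s * ennreal (infdist s A) \<partial>M) * n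
      + ennreal e * (\<integral>\<^sup>+t. indicator V t * ennreal (infdist t A) \<partial>N) * m"
proof -
  let ?D = "\<integral>\<^sup>+t. indicator V t * ennreal (infdist t A) \<partial>N"
  have c: "continuous_on UNIV (\<lambda>x. infdist x A)"
    by (intro continuous_intros)
  have [measurable]: "(\<lambda>x. infdist x A) \<in> borel_measurable M" "(\<lambda>x. infdist x A) \<in> borel_measurable N"
      "U \<in> sets M" "V \<in> sets N"
    using borel_measurable_continuous_onI[OF c] s U by (simp_all cong: measurable_cong_sets)
  have inner: "(\<integral>\<^sup>+t. indicator V t * ennreal (dbar A s t) \<partial>N) \<le>
      ennreal (dbar A x y) * n + ennreal e * ennreal (infdist s A) * n + ennreal e * ?D" if "s \<in> U" for s
  proof -
    have "(\<integral>\<^sup>+t. indicator V t * ennreal (dbar A s t) \<partial>N) \<le>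
        (\<integral>\<^sup>+t. (ennreal (dbar A x y) + ennreal e * ennreal (infdist s A)) * indicator V t +
          ennreal e * (indicator V t * ennreal (infdist t A)) \<partial>N)"
    proof (rule nn_integral_mono)
      fix t
      have "ennreal (dbar A s t) \<le> ennreal (dbar A x y) + ennreal e * ennreal (infdist s A) + ennreal e * ennreal (infdist t A)"
        if "t \<in> V"
      proof -
        have "dbar A s t \<le> dbar A x y + e * infdist s A + e * infdist t A"
          using dbar_lipschitz[of A s t x y] near(1)[OF \<open>s \<in> U\<close>] near(2)[OF that] by linarith
        then have "ennreal (dbar A s t) \<le> ennreal (dbar A x y + e * infdist s A + e * infdist t A)"
          by (rule ennreal_leI)
        also have "\<dots> = ennreal (dbar A x y) + ennreal e * ennreal (infdist s A) + ennreal e * ennreal (infdist t A)"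
          using e by (simp add: ennreal_plus ennreal_mult dbar_nonneg infdist_nonneg)
        finally show ?thesis .
      qed
      then show "indicator V t * ennreal (dbar A s t) \<le>
          (ennreal (dbar A x y) + ennreal e * ennreal (infdist s A)) * indicator V t +
          ennreal e * (indicator V t * ennreal (infdist t A))"
        by (auto simp: indicator_def)
    qed
    also have "\<dots> = (ennreal (dbar A x y) + ennreal e * ennreal (infdist s A)) * n + ennreal e * ?D"
      using mn by (simp add: nn_integral_add nn_integral_cmult)
    finally show ?thesis
      by (simp add: distrib_right)
  qed
  have "(\<integral>\<^sup>+s. indicator U s * (\<integral>\<^sup>+t. indicator V t * ennreal (dbar A s t) \<partial>N) \<partial>M) \<le>
      (\<integral>\<^sup>+s. (ennreal (dbar A x y) * n + ennreal e * ?D) * indicator U s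
        + ennreal e * n * (indicator U s * ennreal (infdist s A)) \<partial>M)"
    using inner by (intro nn_integral_mono) (auto simp: indicator_def ac_simps)
  also have "\<dots> = (ennreal (dbar A x y) * n + ennreal e * ?D) * m
      + ennreal e * n * (\<integral>\<^sup>+s. indicator U s * ennreal (infdist s A) \<partial>M)"
    using mn by (simp add: nn_integral_add nn_integral_cmult)
  finally show ?thesis
    by (simp add: distrib_left distrib_right ac_simps)
qed

text \<open>A fraction \<open>w\<close> of the piece is moved to other pieces and pays only the
  error e D, where D is the integral of \<open>infdist _ A\<close> over the piece. The rest goes to
  \<open>A\<close> and pays D itself, which is at most its value at the centre plus e D. The two
  errors carry weights \<open>w\<close> and \<open>1 - w\<close>, so together they make just one e
  D.\<close>

lemma nn_integral_step_cost:
  fixes M :: "'a::{metric_space,second_countable_topology} measure"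
  assumes s: "sets M = sets borel" and U: "U \<in> sets borel"
    and m: "emeasure M U = ennreal m" "0 \<le> m" and w: "0 \<le> w" "w \<le> 1"
    and e: "0 \<le> e" and near: "\<And>z. z \<in> U \<Longrightarrow> dist z x \<le> e * infdist z A"
  shows "ennreal w * (ennreal e * (\<integral>\<^sup>+s. indicator U s * ennreal (infdist s A) \<partial>M))
      + ennreal (1 - w) * (\<integral>\<^sup>+s. indicator U s * ennreal (infdist s A) \<partial>M)
    \<le> ennreal ((1 - w) * m * infdist x A) + ennreal e * (\<integral>\<^sup>+s. indicator U s * ennreal (infdist s A) \<partial>M)"
proof -
  let ?D = "\<integral>\<^sup>+s. indicator U s * ennreal (infdist s A) \<partial>M"
  have c: "continuous_on UNIV (\<lambda>x. infdist x A)"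
    by (intro continuous_intros)
  have [measurable]: "(\<lambda>x. infdist x A) \<in> borel_measurable M" "U \<in> sets M"
    using borel_measurable_continuous_onI[OF c] s U by (simp_all cong: measurable_cong_sets)
  have "?D \<le> (\<integral>\<^sup>+s. ennreal (infdist x A) * indicator U s + ennreal e * (indicator U s * ennreal (infdist s A)) \<partial>M)"
  proof (rule nn_integral_mono)
    fix z
    have "ennreal (infdist z A) \<le> ennreal (infdist x A) + ennreal e * ennreal (infdist z A)" if "z \<in> U"
      using near[OF that] infdist_triangle[of z A x] e
      by (simp add: ennreal_leI infdist_nonneg flip: ennreal_mult ennreal_plus)
    then show "indicator U z * ennreal (infdist z A) \<le>
        ennreal (infdist x A) * indicator U z + ennreal e * (indicator U z * ennreal (infdist z A))"
      by (auto simp: indicator_def)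
  qed
  also have "\<dots> = ennreal (infdist x A) * ennreal m + ennreal e * ?D"
    using m by (simp add: nn_integral_add nn_integral_cmult)
  finally have "ennreal (1 - w) * ?D \<le> ennreal (1 - w) * (ennreal (infdist x A) * ennreal m + ennreal e * ?D)"
    by (intro mult_left_mono) auto
  also have "\<dots> = ennreal ((1 - w) * m * infdist x A) + ennreal (1 - w) * (ennreal e * ?D)"
    using w m by (simp add: distrib_left ennreal_mult infdist_nonneg ac_simps)
  finally have "ennreal w * (ennreal e * ?D) + ennreal (1 - w) * ?D \<le>
      ennreal w * (ennreal e * ?D) + (ennreal ((1 - w) * m * infdist x A) + ennreal (1 - w) * (ennreal e * ?D))"
    by (intro add_left_mono)
  also have "\<dots> = ennreal ((1 - w) * m * infdist x A) + (ennreal w + ennreal (1 - w)) * (ennreal e * ?D)"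
    by (simp only: distrib_left distrib_right ac_simps)
  also have "ennreal w + ennreal (1 - w) = 1"
    using w by (simp flip: ennreal_plus)
  finally show ?thesis by simp
qed

text \<open>The plan is the block plan for \<open>l\<close>, plus the leftover of \<open>M\<close>
  sent to \<open>a\<close>, plus the leftover of \<open>N\<close> brought from \<open>a\<close>. The
  unwanted marginals of the last two parts sit at \<open>a\<close>, where a relative measure does
  not see them; this is how unequal masses are balanced.\<close>

lemma exists_plan:
  fixes M N :: "'a::{metric_space,second_countable_topology} measure"
    and m n :: "'i \<Rightarrow> real" and l :: "'i \<Rightarrow> 'i \<Rightarrow> real"
  assumes s: "sets M = sets borel" "sets N = sets borel"
    and A: "A \<in> sets borel" "a \<in> A"
    and I: "finite I" and U: "\<And>i. i \<in> I \<Longrightarrow> U i \<in> sets borel" "\<And>i. i \<in> I \<Longrightarrow> U i \<subseteq> - A"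
    and dis: "disjoint_family_on U I"
    and near: "\<And>i z. i \<in> I \<Longrightarrow> z \<in> U i \<Longrightarrow> dist z (x i) \<le> e * infdist z A" and e: "0 \<le> e"
    and m: "\<And>i. i \<in> I \<Longrightarrow> emeasure M (U i) = ennreal (m i)" "\<And>i. i \<in> I \<Longrightarrow> 0 \<le> m i"
    and n: "\<And>i. i \<in> I \<Longrightarrow> emeasure N (U i) = ennreal (n i)" "\<And>i. i \<in> I \<Longrightarrow> 0 \<le> n i"
    and l: "\<And>i j. i \<in> I \<Longrightarrow> j \<in> I \<Longrightarrow> 0 \<le> l i j"
    and u: "\<And>i. i \<in> I \<Longrightarrow> 0 \<le> u i" "\<And>i. i \<in> I \<Longrightarrow> (\<Sum>j\<in>I. l i j) + u i = m i"
    and v: "\<And>i. i \<in> I \<Longrightarrow> 0 \<le> v i" "\<And>j. j \<in> I \<Longrightarrow> (\<Sum>i\<in>I. l i j) + v j = n j"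
  defines "R \<equiv> - A - (\<Union>i\<in>I. U i)"
  shows "\<exists>\<pi>. sets \<pi> = sets borel \<and>
    (\<forall>E\<in>sets borel. E \<subseteq> - A \<longrightarrow> emeasure (distr \<pi> borel fst) E = emeasure M E) \<and>
    (\<forall>E\<in>sets borel. E \<subseteq> - A \<longrightarrow> emeasure (distr \<pi> borel snd) E = emeasure N E) \<and>
    (\<integral>\<^sup>+z. ennreal (dbar A (fst z) (snd z)) \<partial>\<pi>) \<le>
      ennreal ((\<Sum>i\<in>I. \<Sum>j\<in>I. l i j * dbar A (x i) (x j)) +
        (\<Sum>i\<in>I. u i * infdist (x i) A) + (\<Sum>i\<in>I. v i * infdist (x i) A))
      + (ennreal e * (\<integral>\<^sup>+z. ennreal (infdist z A) \<partial>M) + (\<integral>\<^sup>+z. indicator R z * ennreal (infdist z A) \<partial>M))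
      + (ennreal e * (\<integral>\<^sup>+z. ennreal (infdist z A) \<partial>N) + (\<integral>\<^sup>+z. indicator R z * ennreal (infdist z A) \<partial>N))"
proof -
  \<comment> \<open>Normalised so that the block of \<open>U i\<close> and \<open>U j\<close>
    receives mass \<open>l i j\<close>. Pieces of mass zero are harmless: there
    \<open>l i j = 0\<close>, which agrees with division by zero.\<close>
  define L where "L = (\<lambda>i j. l i j / (m i * n j))"
  \<comment> \<open>The fraction of piece i that is matched with other pieces;
    \<open>1 - w i\<close> is the fraction given to \<open>A\<close>, of mass \<open>u i\<close>.
    Likewise \<open>w'\<close> and \<open>v\<close> on the side of \<open>N\<close>.\<close>
  define w where "w = (\<lambda>i. (\<Sum>j\<in>I. l i j) / m i)"
  define w' where "w' = (\<lambda>j. (\<Sum>i\<in>I. l i j) / n j)"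
  have lm: "l i j = 0" if "i \<in> I" "j \<in> I" "m i = 0" for i j
    using u[OF that(1)] sum_nonneg[of I "l i"] l that I by (auto simp: add_nonneg_eq_0_iff sum_nonneg_eq_0_iff)
  have ln: "l i j = 0" if "i \<in> I" "j \<in> I" "n j = 0" for i j
    using v[OF that(2)] sum_nonneg[of I "\<lambda>i. l i j"] l that I by (auto simp: add_nonneg_eq_0_iff sum_nonneg_eq_0_iff)
  have L0: "0 \<le> L i j" if "i \<in> I" "j \<in> I" for i j
    using l m n that by (simp add: L_def)
  have Lmn: "L i j * (m i * n j) = l i j" if "i \<in> I" "j \<in> I" for i j
    using lm ln that by (auto simp: L_def)
  have Ln: "(\<Sum>j\<in>I. L i j * n j) = w i" if "i \<in> I" for i
    using ln that by (auto simp: L_def w_def sum_divide_distrib intro!: sum.cong)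
  have Lm: "(\<Sum>i\<in>I. L i j * m i) = w' j" if "j \<in> I" for j
    using lm that by (auto simp: L_def w'_def sum_divide_distrib intro!: sum.cong)
  have w01: "0 \<le> w i" "w i \<le> 1" if "i \<in> I" for i
    using u[OF that] m(2)[OF that] l that by (auto simp: w_def divide_le_eq intro!: divide_nonneg_nonneg sum_nonneg)
  have w'01: "0 \<le> w' i" "w' i \<le> 1" if "i \<in> I" for i
    using v[OF that] n(2)[OF that] l that by (auto simp: w'_def divide_le_eq intro!: divide_nonneg_nonneg sum_nonneg)
  have wu: "(1 - w i) * m i = u i" if "i \<in> I" for i
    using u[OF that] lm[OF that] by (cases "m i = 0") (auto simp: w_def left_diff_distrib)
  have w'v: "(1 - w' i) * n i = v i" if "i \<in> I" for i
    using v[OF that] ln[OF _ that] by (cases "n i = 0") (auto simp: w'_def left_diff_distrib)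
  have Rb: "R \<in> sets borel"
    unfolding R_def using A I U(1) by (intro sets.Diff borel_comp sets.finite_UN) auto
  define \<rho> where "\<rho> = (\<lambda>x. indicator R x + (\<Sum>i\<in>I. ennreal (1 - w i) * indicator (U i) x))"
  define \<sigma> where "\<sigma> = (\<lambda>x. indicator R x + (\<Sum>i\<in>I. ennreal (1 - w' i) * indicator (U i) x))"
  define \<pi>1 where "\<pi>1 = block_plan I U (\<lambda>i j. ennreal (L i j)) M N"
  define \<pi>2 where "\<pi>2 = distr (density M \<rho>) borel (\<lambda>x. (x, a))"
  define \<pi>3 where "\<pi>3 = distr (density N \<sigma>) borel (\<lambda>y. (a, y))"
  define \<pi> where "\<pi> = add_measure \<pi>1 (add_measure \<pi>2 \<pi>3)"
  have fin: "\<And>i. i \<in> I \<Longrightarrow> emeasure M (U i) < \<infinity>" "\<And>i. i \<in> I \<Longrightarrow> emeasure N (U i) < \<infinity>"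
    using m n by auto
  note b = s I U(1) fin
  have s1: "sets \<pi>1 = sets borel" "sets \<pi>2 = sets borel" "sets \<pi>3 = sets borel"
    using sets_block_plan[OF b] by (simp_all add: \<pi>1_def \<pi>2_def \<pi>3_def)
  then have s\<pi>: "sets \<pi> = sets borel"
    by (simp add: \<pi>_def)
  have UM: "\<And>i. i \<in> I \<Longrightarrow> U i \<in> sets M" "\<And>i. i \<in> I \<Longrightarrow> U i \<in> sets N" "R \<in> sets M" "R \<in> sets N"
    using U Rb s by auto
  have int: "(\<integral>\<^sup>+z. k z \<partial>\<pi>) = (\<integral>\<^sup>+z. k z \<partial>\<pi>1)
      + ((\<integral>\<^sup>+x. indicator R x * k (x, a) \<partial>M) + (\<Sum>i\<in>I. ennreal (1 - w i) * (\<integral>\<^sup>+x. indicator (U i) x * k (x, a) \<partial>M)))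
      + ((\<integral>\<^sup>+x. indicator R x * k (a, x) \<partial>N) + (\<Sum>i\<in>I. ennreal (1 - w' i) * (\<integral>\<^sup>+x. indicator (U i) x * k (a, x) \<partial>N)))"
    if k: "k \<in> borel_measurable borel" for k
  proof -
    have ka: "(\<lambda>x. k (x, a)) \<in> borel_measurable M" "(\<lambda>x. k (a, x)) \<in> borel_measurable N"
      using s by (auto intro!: measurable_compose[OF _ k] borel_measurable_Pair cong: measurable_cong_sets)
    have Pa: "(\<lambda>x. (x, a)) \<in> borel_measurable M" "(\<lambda>x. (a, x)) \<in> borel_measurable N"
      using s by (auto intro!: borel_measurable_Pair cong: measurable_cong_sets)
    have rs: "\<rho> \<in> borel_measurable M" "\<sigma> \<in> borel_measurable N"
      using UM by (auto simp: \<rho>_def \<sigma>_def intro!: borel_measurable_add borel_measurable_sum borel_measurable_times)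
    have "(\<integral>\<^sup>+z. k z \<partial>\<pi>) = (\<integral>\<^sup>+z. k z \<partial>\<pi>1) + ((\<integral>\<^sup>+z. k z \<partial>\<pi>2) + (\<integral>\<^sup>+z. k z \<partial>\<pi>3))"
      unfolding \<pi>_def using s1 k by (simp add: nn_integral_add_measure cong: measurable_cong_sets)
    also have "(\<integral>\<^sup>+z. k z \<partial>\<pi>2) = (\<integral>\<^sup>+x. \<rho> x * k (x, a) \<partial>M)"
      unfolding \<pi>2_def using k ka Pa rs by (simp add: nn_integral_distr nn_integral_density)
    also have "(\<integral>\<^sup>+z. k z \<partial>\<pi>3) = (\<integral>\<^sup>+x. \<sigma> x * k (a, x) \<partial>N)"
      unfolding \<pi>3_def using k ka Pa rs by (simp add: nn_integral_distr nn_integral_density)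
    finally show ?thesis
      unfolding \<rho>_def \<sigma>_def using nn_integral_restricted_step[OF I UM(1) UM(3) ka(1)]
        nn_integral_restricted_step[OF I UM(2) UM(4) ka(2)] by (simp add: add.assoc)
  qed
  have part: "(\<integral>\<^sup>+x. f x \<partial>Q) = (\<integral>\<^sup>+x. indicator R x * f x \<partial>Q) + (\<Sum>i\<in>I. \<integral>\<^sup>+x. indicator (U i) x * f x \<partial>Q)"
    if "sets Q = sets borel" "f \<in> borel_measurable borel" "\<And>x. x \<in> A \<Longrightarrow> f x = 0" for Q and f :: "'a \<Rightarrow> ennreal"
    using that U Rb by (intro nn_integral_partition I dis) (auto simp: R_def cong: measurable_cong_sets)
  \<comment> \<open>Matched and unmatched fractions of a piece recombine to the whole piece, which
    yields both marginals.\<close>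
  have split: "ennreal t * X + ennreal (1 - t) * X = X" if "0 \<le> t" "t \<le> 1" for t X
    using that by (simp flip: distrib_right ennreal_plus)
  have infm: "(\<lambda>x. infdist x A) \<in> borel_measurable borel"
    by (intro borel_measurable_continuous_onI continuous_intros)
  show ?thesis
  proof (intro exI[of _ \<pi>] conjI ballI impI)
    show "sets \<pi> = sets borel" by (rule s\<pi>)
    fix E assume E: "E \<in> sets borel" "E \<subseteq> - A"
    have fm: "fst \<in> borel_measurable \<pi>" "snd \<in> borel_measurable \<pi>"
      using s\<pi> by (auto intro!: borel_measurable_continuous_onI continuous_intros cong: measurable_cong_sets)
    have kE: "(\<lambda>z. indicator E (fst z) :: ennreal) \<in> borel_measurable (borel :: ('a \<times> 'a) measure)"
        "(\<lambda>z. indicator E (snd z) :: ennreal) \<in> borel_measurable (borel :: ('a \<times> 'a) measure)"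
      using measurable_compose[OF _ borel_measurable_indicator[OF E(1)], of fst "borel :: ('a \<times> 'a) measure"]
        measurable_compose[OF _ borel_measurable_indicator[OF E(1)], of snd "borel :: ('a \<times> 'a) measure"]
      by (simp_all add: borel_measurable_continuous_onI continuous_on_fst continuous_on_snd continuous_on_id)
    have E0: "indicator E a = (0::ennreal)"
      using E A by (auto simp: indicator_def)
    have Em: "(indicator E :: 'a \<Rightarrow> ennreal) \<in> borel_measurable borel" "\<And>x. x \<in> A \<Longrightarrow> indicator E x = (0::ennreal)"
      using E by (auto simp: indicator_def)
    have "emeasure (distr \<pi> borel fst) E = (\<integral>\<^sup>+z. indicator E (fst z) \<partial>\<pi>)"
      using E fm by (simp add: nn_integral_distr flip: nn_integral_indicator)
    also have "\<dots> = (\<integral>\<^sup>+z. indicator E (fst z) \<partial>\<pi>1) + ((\<integral>\<^sup>+x. indicator R x * indicator E x \<partial>M)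
        + (\<Sum>i\<in>I. ennreal (1 - w i) * (\<integral>\<^sup>+x. indicator (U i) x * indicator E x \<partial>M)))"
      by (subst int[OF kE(1)]) (simp add: E0)
    also have "(\<integral>\<^sup>+z. indicator E (fst z) \<partial>\<pi>1) =
        (\<Sum>i\<in>I. ennreal (w i) * (\<integral>\<^sup>+x. indicator (U i) x * indicator E x \<partial>M))"
    proof -
      have "(\<integral>\<^sup>+x. indicator (U i) x * (\<integral>\<^sup>+y. indicator (U j) y * indicator E x \<partial>N) \<partial>M) =
          ennreal (n j) * (\<integral>\<^sup>+x. indicator (U i) x * indicator E x \<partial>M)" if "i \<in> I" "j \<in> I" for i j
        using UM n E s that by (simp add: nn_integral_multc nn_integral_cmult mult.left_commute[of _ "ennreal (n j)"] flip: mult.assoc)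
           (simp add: nn_integral_cmult mult.commute mult.left_commute)
      then have "(\<integral>\<^sup>+z. indicator E (fst z) \<partial>\<pi>1) = (\<Sum>i\<in>I. \<Sum>j\<in>I. ennreal (L i j) * (ennreal (n j) *
          (\<integral>\<^sup>+x. indicator (U i) x * indicator E x \<partial>M)))"
        unfolding \<pi>1_def by (subst nn_integral_block_plan_fst[OF b kE(1)]) (auto intro!: sum.cong)
      also have "\<dots> = (\<Sum>i\<in>I. (\<Sum>j\<in>I. ennreal (L i j * n j)) * (\<integral>\<^sup>+x. indicator (U i) x * indicator E x \<partial>M))"
        using L0 n by (auto intro!: sum.cong simp: sum_distrib_right ennreal_mult mult.assoc)
      also have "\<dots> = (\<Sum>i\<in>I. ennreal (w i) * (\<integral>\<^sup>+x. indicator (U i) x * indicator E x \<partial>M))"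
        using L0 n Ln by (auto intro!: sum.cong simp: sum_ennreal)
      finally show ?thesis .
    qed
    also have "\<dots> + ((\<integral>\<^sup>+x. indicator R x * indicator E x \<partial>M)
        + (\<Sum>i\<in>I. ennreal (1 - w i) * (\<integral>\<^sup>+x. indicator (U i) x * indicator E x \<partial>M))) =
        (\<integral>\<^sup>+x. indicator R x * indicator E x \<partial>M) + (\<Sum>i\<in>I. \<integral>\<^sup>+x. indicator (U i) x * indicator E x \<partial>M)"
      using w01 by (simp add: split add.left_commute flip: sum.distrib)
    also have "\<dots> = emeasure M E"
      using part[OF s(1) Em] E s by simp
    finally show "emeasure (distr \<pi> borel fst) E = emeasure M E" .
    have "emeasure (distr \<pi> borel snd) E = (\<integral>\<^sup>+z. indicator E (snd z) \<partial>\<pi>)"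
      using E fm by (simp add: nn_integral_distr flip: nn_integral_indicator)
    also have "\<dots> = (\<integral>\<^sup>+z. indicator E (snd z) \<partial>\<pi>1) + ((\<integral>\<^sup>+x. indicator R x * indicator E x \<partial>N)
        + (\<Sum>i\<in>I. ennreal (1 - w' i) * (\<integral>\<^sup>+x. indicator (U i) x * indicator E x \<partial>N)))"
      by (subst int[OF kE(2)]) (simp add: E0)
    also have "(\<integral>\<^sup>+z. indicator E (snd z) \<partial>\<pi>1) =
        (\<Sum>i\<in>I. ennreal (w' i) * (\<integral>\<^sup>+x. indicator (U i) x * indicator E x \<partial>N))"
    proof -
      have "(\<integral>\<^sup>+x. indicator (U j) x * (\<integral>\<^sup>+y. indicator (U i) y * indicator E x \<partial>M) \<partial>N) =
          ennreal (m i) * (\<integral>\<^sup>+x. indicator (U j) x * indicator E x \<partial>N)" if "i \<in> I" "j \<in> I" for i j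
        using UM m E s that by (simp add: nn_integral_multc nn_integral_cmult mult.left_commute[of _ "ennreal (m i)"] flip: mult.assoc)
           (simp add: nn_integral_cmult mult.commute mult.left_commute)
      then have "(\<integral>\<^sup>+z. indicator E (snd z) \<partial>\<pi>1) = (\<Sum>i\<in>I. \<Sum>j\<in>I. ennreal (L i j) * (ennreal (m i) *
          (\<integral>\<^sup>+x. indicator (U j) x * indicator E x \<partial>N)))"
        unfolding \<pi>1_def by (subst nn_integral_block_plan_snd[OF b kE(2)]) (auto intro!: sum.cong)
      also have "\<dots> = (\<Sum>j\<in>I. (\<Sum>i\<in>I. ennreal (L i j * m i)) * (\<integral>\<^sup>+x. indicator (U j) x * indicator E x \<partial>N))"
        using L0 m by (subst sum.swap) (auto intro!: sum.cong simp: sum_distrib_right ennreal_mult mult.assoc)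
      also have "\<dots> = (\<Sum>i\<in>I. ennreal (w' i) * (\<integral>\<^sup>+x. indicator (U i) x * indicator E x \<partial>N))"
        using L0 m Lm by (auto intro!: sum.cong simp: sum_ennreal)
      finally show ?thesis .
    qed
    also have "\<dots> + ((\<integral>\<^sup>+x. indicator R x * indicator E x \<partial>N)
        + (\<Sum>i\<in>I. ennreal (1 - w' i) * (\<integral>\<^sup>+x. indicator (U i) x * indicator E x \<partial>N))) =
        (\<integral>\<^sup>+x. indicator R x * indicator E x \<partial>N) + (\<Sum>i\<in>I. \<integral>\<^sup>+x. indicator (U i) x * indicator E x \<partial>N)"
      using w'01 by (simp add: split add.left_commute flip: sum.distrib)
    also have "\<dots> = emeasure N E"
      using part[OF s(2) Em] E s by simp
    finally show "emeasure (distr \<pi> borel snd) E = emeasure N E" .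
  next
    let ?D = "\<lambda>Q i. \<integral>\<^sup>+s. indicator (U i) s * ennreal (infdist s A) \<partial>Q"
    let ?R = "\<lambda>Q. \<integral>\<^sup>+s. indicator R s * ennreal (infdist s A) \<partial>Q"
    have "(\<integral>\<^sup>+z. ennreal (dbar A (fst z) (snd z)) \<partial>\<pi>1) \<le>
        (\<Sum>i\<in>I. \<Sum>j\<in>I. ennreal (L i j) * (ennreal (dbar A (x i) (x j)) * ennreal (m i) * ennreal (n j)
          + ennreal e * ?D M i * ennreal (n j) + ennreal e * ?D N j * ennreal (m i)))"
      unfolding \<pi>1_def
      by (subst nn_integral_block_plan_fst[OF b])
        (auto intro!: sum_mono mult_left_mono nn_integral_block_cost s U m n e near)
    \<comment> \<open>The last sum is taken in the opposite order, so that the inner sums of the two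
      error terms collapse to \<open>w i\<close> and \<open>w' j\<close>.\<close>
    also have "\<dots> = (\<Sum>i\<in>I. \<Sum>j\<in>I. ennreal (L i j) * (ennreal (dbar A (x i) (x j)) * ennreal (m i) * ennreal (n j)))
        + (\<Sum>i\<in>I. \<Sum>j\<in>I. ennreal (L i j) * ennreal (n j) * (ennreal e * ?D M i))
        + (\<Sum>j\<in>I. \<Sum>i\<in>I. ennreal (L i j) * ennreal (m i) * (ennreal e * ?D N j))"
      by (subst (4) sum.swap) (simp add: sum.distrib distrib_left ac_simps)
    also have "\<dots> = ennreal (\<Sum>i\<in>I. \<Sum>j\<in>I. l i j * dbar A (x i) (x j))
        + (\<Sum>i\<in>I. ennreal (w i) * (ennreal e * ?D M i)) + (\<Sum>j\<in>I. ennreal (w' j) * (ennreal e * ?D N j))"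
    proof -
      have "(\<Sum>i\<in>I. \<Sum>j\<in>I. ennreal (L i j) * (ennreal (dbar A (x i) (x j)) * ennreal (m i) * ennreal (n j)))
          = (\<Sum>i\<in>I. \<Sum>j\<in>I. ennreal (l i j * dbar A (x i) (x j)))"
        using L0 m n l by (intro sum.cong refl)
          (simp add: dbar_nonneg ac_simps flip: ennreal_mult Lmn)
      moreover have "(\<Sum>j\<in>I. ennreal (L i j) * ennreal (n j)) = ennreal (w i)" if "i \<in> I" for i
        using that L0 n by (simp flip: ennreal_mult Ln)
      moreover have "(\<Sum>i\<in>I. ennreal (L i j) * ennreal (m i)) = ennreal (w' j)" if "j \<in> I" for j
        using that L0 m by (simp flip: ennreal_mult Lm)
      ultimately show ?thesis
        using l by (simp add: sum_nonneg dbar_nonneg flip: sum_distrib_right)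
    qed
    finally have c1: "(\<integral>\<^sup>+z. ennreal (dbar A (fst z) (snd z)) \<partial>\<pi>1) \<le> \<dots>" .
    have cM: "(\<Sum>i\<in>I. ennreal (w i) * (ennreal e * ?D M i)) + (\<Sum>i\<in>I. ennreal (1 - w i) * ?D M i)
        \<le> ennreal (\<Sum>i\<in>I. u i * infdist (x i) A) + ennreal e * (\<integral>\<^sup>+z. ennreal (infdist z A) \<partial>M)"
    proof -
      have "(\<Sum>i\<in>I. ennreal (w i) * (ennreal e * ?D M i)) + (\<Sum>i\<in>I. ennreal (1 - w i) * ?D M i)
          \<le> (\<Sum>i\<in>I. ennreal ((1 - w i) * m i * infdist (x i) A) + ennreal e * ?D M i)"
        unfolding sum.distrib[symmetric]
        by (intro sum_mono nn_integral_step_cost s U m w01 e near)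
      also have "\<dots> = ennreal (\<Sum>i\<in>I. u i * infdist (x i) A) + ennreal e * (\<Sum>i\<in>I. ?D M i)"
        using wu u by (simp add: sum.distrib sum_distrib_left infdist_nonneg flip: sum_ennreal)
      also have "\<dots> \<le> ennreal (\<Sum>i\<in>I. u i * infdist (x i) A) + ennreal e * (\<integral>\<^sup>+z. ennreal (infdist z A) \<partial>M)"
        using part[OF s(1), of "\<lambda>z. ennreal (infdist z A)"] infm by (intro add_left_mono mult_left_mono) simp_all
      finally show ?thesis .
    qed
    have cN: "(\<Sum>i\<in>I. ennreal (w' i) * (ennreal e * ?D N i)) + (\<Sum>i\<in>I. ennreal (1 - w' i) * ?D N i)
        \<le> ennreal (\<Sum>i\<in>I. v i * infdist (x i) A) + ennreal e * (\<integral>\<^sup>+z. ennreal (infdist z A) \<partial>N)"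
    proof -
      have "(\<Sum>i\<in>I. ennreal (w' i) * (ennreal e * ?D N i)) + (\<Sum>i\<in>I. ennreal (1 - w' i) * ?D N i)
          \<le> (\<Sum>i\<in>I. ennreal ((1 - w' i) * n i * infdist (x i) A) + ennreal e * ?D N i)"
        unfolding sum.distrib[symmetric]
        by (intro sum_mono nn_integral_step_cost s U n w'01 e near)
      also have "\<dots> = ennreal (\<Sum>i\<in>I. v i * infdist (x i) A) + ennreal e * (\<Sum>i\<in>I. ?D N i)"
        using w'v v by (simp add: sum.distrib sum_distrib_left infdist_nonneg flip: sum_ennreal)
      also have "\<dots> \<le> ennreal (\<Sum>i\<in>I. v i * infdist (x i) A) + ennreal e * (\<integral>\<^sup>+z. ennreal (infdist z A) \<partial>N)"
        using part[OF s(2), of "\<lambda>z. ennreal (infdist z A)"] infm by (intro add_left_mono mult_left_mono) simp_all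
      finally show ?thesis .
    qed
    have "(\<integral>\<^sup>+z. ennreal (dbar A (fst z) (snd z)) \<partial>\<pi>) = (\<integral>\<^sup>+z. ennreal (dbar A (fst z) (snd z)) \<partial>\<pi>1)
        + (?R M + (\<Sum>i\<in>I. ennreal (1 - w i) * ?D M i)) + (?R N + (\<Sum>i\<in>I. ennreal (1 - w' i) * ?D N i))"
      by (subst int) (auto simp: dbar_left[OF A(2)] dbar_right[OF A(2)])
    also have "\<dots> \<le> (ennreal (\<Sum>i\<in>I. \<Sum>j\<in>I. l i j * dbar A (x i) (x j))
        + (\<Sum>i\<in>I. ennreal (w i) * (ennreal e * ?D M i)) + (\<Sum>j\<in>I. ennreal (w' j) * (ennreal e * ?D N j)))
        + (?R M + (\<Sum>i\<in>I. ennreal (1 - w i) * ?D M i)) + (?R N + (\<Sum>i\<in>I. ennreal (1 - w' i) * ?D N i))"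
      by (intro add_right_mono c1)
    also have "\<dots> = ennreal (\<Sum>i\<in>I. \<Sum>j\<in>I. l i j * dbar A (x i) (x j))
        + (((\<Sum>i\<in>I. ennreal (w i) * (ennreal e * ?D M i)) + (\<Sum>i\<in>I. ennreal (1 - w i) * ?D M i)) + ?R M)
        + (((\<Sum>i\<in>I. ennreal (w' i) * (ennreal e * ?D N i)) + (\<Sum>i\<in>I. ennreal (1 - w' i) * ?D N i)) + ?R N)"
      by (simp only: ac_simps)
    also have "\<dots> \<le> ennreal (\<Sum>i\<in>I. \<Sum>j\<in>I. l i j * dbar A (x i) (x j))
        + ((ennreal (\<Sum>i\<in>I. u i * infdist (x i) A) + ennreal e * (\<integral>\<^sup>+z. ennreal (infdist z A) \<partial>M)) + ?R M)
        + ((ennreal (\<Sum>i\<in>I. v i * infdist (x i) A) + ennreal e * (\<integral>\<^sup>+z. ennreal (infdist z A) \<partial>N)) + ?R N)"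
      by (intro add_mono order_refl cM cN)
    also have "\<dots> = ennreal ((\<Sum>i\<in>I. \<Sum>j\<in>I. l i j * dbar A (x i) (x j)) +
        (\<Sum>i\<in>I. u i * infdist (x i) A) + (\<Sum>i\<in>I. v i * infdist (x i) A))
        + (ennreal e * (\<integral>\<^sup>+z. ennreal (infdist z A) \<partial>M) + ?R M) + (ennreal e * (\<integral>\<^sup>+z. ennreal (infdist z A) \<partial>N) + ?R N)"
      using l u v by (simp add: ennreal_plus sum_nonneg dbar_nonneg infdist_nonneg ac_simps)
    finally show "(\<integral>\<^sup>+z. ennreal (dbar A (fst z) (snd z)) \<partial>\<pi>) \<le> \<dots>" .
  qed
qed

section \<open>Duality\<close>

text \<open>
  McShane extension for \<open>dbar A\<close>, capped by the distance to \<open>A\<close>; it turns a pair of dual variables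
  of the finite problem into a single potential that is at least as good.
\<close>

lemma potential_extension:
  fixes A :: "'a::metric_space set" and f g :: "'i \<Rightarrow> real"
  assumes I: "finite I" and A: "A \<noteq> {}"
    and fg: "\<And>i j. i \<in> I \<Longrightarrow> j \<in> I \<Longrightarrow> f i - g j \<le> dbar A (x i) (x j)"
    and f: "\<And>i. i \<in> I \<Longrightarrow> f i \<le> infdist (x i) A" and g: "\<And>i. i \<in> I \<Longrightarrow> - g i \<le> infdist (x i) A"
  obtains F where "1-lipschitz_on UNIV F" "\<And>z. z \<in> A \<Longrightarrow> F z = 0"
    "\<And>i. i \<in> I \<Longrightarrow> f i \<le> F (x i)" "\<And>i. i \<in> I \<Longrightarrow> F (x i) \<le> g i"
proof
  let ?S = "\<lambda>z. insert (infdist z A) ((\<lambda>j. g j + dbar A z (x j)) ` I)"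
  define F where "F = (\<lambda>z. Min (?S z))"
  have fin: "finite (?S z)" "?S z \<noteq> {}" for z
    using I by auto
  have le: "F y \<le> F z + dist y z" for y z
  proof -
    have "F z \<in> ?S z"
      unfolding F_def by (rule Min_in[OF fin])
    then consider "F z = infdist z A" | j where "j \<in> I" "F z = g j + dbar A z (x j)"
      by auto
    then show ?thesis
    proof cases
      case 1
      have "F y \<le> infdist y A"
        unfolding F_def using fin by (intro Min_le) auto
      then show ?thesis
        using 1 infdist_triangle[of y A z] by linarith
    next
      case 2
      have "F y \<le> g j + dbar A y (x j)"
        unfolding F_def using fin 2 by (intro Min_le) auto
      then show ?thesis
        using 2 dbar_lipschitz[of A y "x j" z "x j"] by simp
    qed
  qed
  show "1-lipschitz_on UNIV F"
  proof (rule lipschitz_onI)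
    show "dist (F y) (F z) \<le> 1 * dist y z" for y z
      using le[of y z] le[of z y] by (simp add: dist_real_def dist_commute)
  qed simp
  \<comment> \<open>The cap gives \<open>F z \<le> 0\<close>. The reverse inequality is where
    \<open>- g i \<le> infdist (x i) A\<close>, the constraint dual to \<open>v\<close>,
    enters.\<close>
  show "F z = 0" if z: "z \<in> A" for z
  proof (rule antisym)
    show "F z \<le> 0"
      unfolding F_def using fin z by (intro Min_le) auto
    have "0 \<le> g j + dbar A z (x j)" if "j \<in> I" for j
      using g[OF that] by (simp add: dbar_left[OF z])
    then show "0 \<le> F z"
      unfolding F_def using fin by (subst Min_ge_iff) (auto simp: infdist_nonneg)
  qed
  show "f i \<le> F (x i)" if "i \<in> I" for i
    unfolding F_def using fin f fg that by (subst Min_ge_iff) (auto simp: diff_le_eq add.commute)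
  show "F (x i) \<le> g i" if "i \<in> I" for i
    unfolding F_def using fin that by (intro Min_le) (auto intro!: image_eqI[of _ _ i])
qed

text \<open>On a piece, \<open>f i \<le> F (x i) \<le> F z + e * infdist z A\<close>. On the
  residual set the step function is 0 while \<open>F\<close> may be as low as
  \<open>- infdist z A\<close>, which the last integral compensates. An upper bound suffices,
  because the lemma is used for \<open>F\<close> on one measure and for \<open>- F\<close> on the
  other.\<close>

lemma step_integral_le:
  fixes M :: "'a::{metric_space,second_countable_topology} measure"
  assumes s: "sets M = sets borel" and A: "A \<in> sets borel" "A \<noteq> {}" and I: "finite I"
    and U: "\<And>i. i \<in> I \<Longrightarrow> U i \<in> sets borel" and dis: "disjoint_family_on U I"
    and near: "\<And>i z. i \<in> I \<Longrightarrow> z \<in> U i \<Longrightarrow> dist z (x i) \<le> e * infdist z A" and e: "0 \<le> e"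
    and m: "\<And>i. i \<in> I \<Longrightarrow> emeasure M (U i) = ennreal (m i)" "\<And>i. i \<in> I \<Longrightarrow> 0 \<le> m i"
    and d: "integrable M (\<lambda>z. infdist z A)"
    and F: "1-lipschitz_on UNIV F" "\<And>z. z \<in> A \<Longrightarrow> F z = 0"
    and f: "\<And>i. i \<in> I \<Longrightarrow> f i \<le> F (x i)"
  defines "R \<equiv> - A - (\<Union>i\<in>I. U i)"
  shows "(\<Sum>i\<in>I. m i * f i) \<le>
    (LINT z|M. F z) + e * (LINT z|M. infdist z A) + (LINT z|M. indicator R z * infdist z A)"
proof -
  have R: "R \<in> sets M"
    unfolding R_def s using A I U by (intro sets.Diff borel_comp sets.finite_UN) auto
  have mF: "F \<in> borel_measurable M"
    using borel_measurable_continuous_onI[OF lipschitz_on_continuous_on[OF F(1)]] s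
    by (auto cong: measurable_cong_sets)
  have F_le: "\<bar>F z\<bar> \<le> infdist z A" for z
    using Lip_bound[OF F A(2), of z] by simp
  then have iF: "integrable M F"
    by (intro Bochner_Integration.integrable_bound[OF d mF]) (auto intro!: AE_I2 simp: infdist_nonneg)
  have iR: "integrable M (\<lambda>z. indicator R z * infdist z A)"
    using integrable_real_mult_indicator[OF R d] by (simp add: mult.commute)
  have iU: "integrable M (\<lambda>z. f i * indicator (U i) z)" if "i \<in> I" for i
    using U that s m by (intro integrable_mult_right integrable_real_indicator) auto
  have "(\<Sum>i\<in>I. m i * f i) = (LINT z|M. (\<Sum>i\<in>I. f i * indicator (U i) z))"
    using iU U s m sets_eq_imp_space_eq[OF s]
    by (subst Bochner_Integration.integral_sum) (auto intro!: sum.cong simp: measure_def)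
  also have "\<dots> \<le> (LINT z|M. F z + e * infdist z A + indicator R z * infdist z A)"
  proof (rule integral_mono)
    show "integrable M (\<lambda>z. \<Sum>i\<in>I. f i * indicator (U i) z)"
      using iU by auto
    show "integrable M (\<lambda>z. F z + e * infdist z A + indicator R z * infdist z A)"
      using iF iR d by auto
    fix z
    show "(\<Sum>i\<in>I. f i * indicator (U i) z) \<le> F z + e * infdist z A + indicator R z * infdist z A"
    proof (cases "\<exists>i\<in>I. z \<in> U i")
      case True
      then obtain i where i: "i \<in> I" "z \<in> U i" by auto
      have "(\<Sum>j\<in>I. f j * indicator (U j) z) = (\<Sum>j\<in>I. if j = i then f j else 0)"
        using i dis by (intro sum.cong) (auto simp: disjoint_family_on_def indicator_def)
      also have "\<dots> = f i"
        using I i by simp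
      also have "\<dots> \<le> F z + e * infdist z A"
        using f[OF i(1)] near[OF i] lipschitz_onD[OF F(1), of "x i" z] by (simp add: dist_real_def dist_commute)
      finally show ?thesis
        using infdist_nonneg[of z A] by (simp add: add_increasing2)
    next
      case False
      then have "(\<Sum>i\<in>I. f i * indicator (U i) z) = 0"
        by (intro sum.neutral) auto
      also have "0 \<le> F z + e * infdist z A + indicator R z * infdist z A"
      proof (cases "z \<in> A")
        case True
        then show ?thesis
          using F(2) by simp
      next
        case outside: False
        then have "indicator R z = (1::real)"
          using False by (simp add: R_def)
        moreover have "0 \<le> e * infdist z A"
          using e by (simp add: infdist_nonneg)
        ultimately show ?thesis
          using F_le[of z] by simp
      qed
      finally show ?thesis .
    qed
  qed
  also have "\<dots> = (LINT z|M. F z) + e * (LINT z|M. infdist z A) + (LINT z|M. indicator R z * infdist z A)"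
    using iF iR d by simp
  finally show ?thesis .
qed

text \<open>Continuity from above needs finite mass, which \<open>M\<close> may lack; it is applied
  to the finite measure \<open>density M d\<close>.\<close>

lemma tail_integral_tendsto_0:
  fixes M :: "'a::topological_space measure" and d :: "'a \<Rightarrow> ennreal"
  assumes s: "sets M = sets borel" and B: "B \<in> sets borel" and U: "\<And>i::nat. U i \<in> sets borel" "(\<Union>i. U i) = B"
    and d: "d \<in> borel_measurable borel" "(\<integral>\<^sup>+z. d z \<partial>M) < \<infinity>"
  shows "(\<lambda>n. \<integral>\<^sup>+z. indicator (B - (\<Union>i<n. U i)) z * d z \<partial>M) \<longlonglongrightarrow> 0"
proof -
  let ?R = "\<lambda>n. B - (\<Union>i<n. U i)"
  have d': "d \<in> borel_measurable M"
    using d s by (simp cong: measurable_cong_sets)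
  have R: "?R n \<in> sets borel" for n
    using B U by (intro sets.Diff sets.finite_UN) auto
  have "(\<lambda>n. emeasure (density M d) (?R n)) \<longlonglongrightarrow> emeasure (density M d) (\<Inter>n. ?R n)"
  proof (rule Lim_emeasure_decseq)
    show "range ?R \<subseteq> sets (density M d)"
      using R s by auto
    show "decseq ?R"
      by (fastforce simp: decseq_def)
    have "emeasure (density M d) (?R n) \<le> (\<integral>\<^sup>+z. d z \<partial>M)" for n
      using R s d' by (subst emeasure_density) (auto intro!: nn_integral_mono simp: indicator_def)
    then show "emeasure (density M d) (?R n) \<noteq> \<infinity>" for n
      using d(2) by (metis infinity_ennreal_def leD top.not_eq_extremum)
  qed
  moreover have "(\<Inter>n. ?R n) = {}"
    using U(2) by auto
  moreover have "emeasure (density M d) (?R n) = (\<integral>\<^sup>+z. indicator (?R n) z * d z \<partial>M)" for n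
    using R s d' by (simp add: emeasure_density mult.commute)
  ultimately show ?thesis
    by (simp only: emeasure_empty)
qed

section \<open>Passage between relative measures and their representatives\<close>

lemma lip_number_le_iff: "f \<in> Lip A \<Longrightarrow> lip_number f \<le> C \<longleftrightarrow> C-lipschitz_on UNIV f"
  by (meson lip_number_least lipschitz_on_le)

text \<open>Agreement off \<open>A\<close> determines the class, so a plan with the right marginals
  off \<open>A\<close> is a coupling in the exact sense of \<open>couplings\<close>.\<close>

lemma relative_measure_eqI:
  assumes A: "A \<in> sets borel" and \<mu>: "\<mu> \<in> relative_measures A" and s: "sets M = sets borel"
    and eq: "\<And>E. E \<in> sets borel \<Longrightarrow> E \<subseteq> - A \<Longrightarrow> emeasure M E = emeasure (rel_rep \<mu>) E"
  shows "rel_measure_eq A `` {M} = \<mu>"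
proof -
  have "(M, rel_rep \<mu>) \<in> rel_measure_eq A"
    using sets_rel_rep[OF A \<mu>] s eq by (simp add: rel_measure_eq_iff[OF A])
  then have "rel_measure_eq A `` {M} = rel_measure_eq A `` {rel_rep \<mu>}"
    by (rule equiv_class_eq[OF equiv_rel_measure_eq[OF A]])
  also obtain X where X: "\<mu> = rel_measure_eq A `` {X}"
    using \<mu> unfolding relative_measures_def by (rule quotientE)
  have "(X, rel_rep \<mu>) \<in> rel_measure_eq A"
    using rel_rep_in[OF A \<mu>] unfolding X by simp
  then have "rel_measure_eq A `` {rel_rep \<mu>} = \<mu>"
    using equiv_class_eq[OF equiv_rel_measure_eq[OF A]] X by metis
  finally show ?thesis .
qed

lemma M1_D:
  assumes "closed A" "\<mu> \<in> M1 A"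
  shows "\<mu> \<in> relative_measures A" "sets (rel_rep \<mu>) = sets borel"
    "(\<integral>\<^sup>+z. ennreal (infdist z A) \<partial>rel_rep \<mu>) < \<infinity>" "integrable (rel_rep \<mu>) (\<lambda>z. infdist z A)"
proof -
  show \<mu>: "\<mu> \<in> relative_measures A" and fin: "(\<integral>\<^sup>+z. ennreal (infdist z A) \<partial>rel_rep \<mu>) < \<infinity>"
    using assms by (auto simp: M1_def rel_nn_integral_def)
  show s: "sets (rel_rep \<mu>) = sets borel"
    using sets_rel_rep[OF _ \<mu>] assms by simp
  have "continuous_on UNIV (\<lambda>z. infdist z A)"
    by (intro continuous_intros)
  then have "(\<lambda>z. infdist z A) \<in> borel_measurable (rel_rep \<mu>)"
    using borel_measurable_continuous_onI s by (auto cong: measurable_cong_sets)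
  then show "integrable (rel_rep \<mu>) (\<lambda>z. infdist z A)"
    using fin by (intro integrableI_nonneg) (auto simp: infdist_nonneg)
qed

text \<open>For each r > 0 a coupling of cost at most s + r is built. The discretisation error
  \<open>\<delta>\<close> is paid twice, first when a finite dual value is compared with
  \<open>s\<close>, then when the finite plan is spread over the pieces; hence the aim
  \<open>\<delta> \<le> r / 2\<close>.\<close>

lemma W1_le:
  fixes A :: "'a::polish_space set"
  assumes A: "closed A" "A \<noteq> {}" and \<mu>: "\<mu> \<in> M1 A" and \<nu>: "\<nu> \<in> M1 A"
    and s: "\<And>f. f \<in> Lip A \<Longrightarrow> lip_number f \<le> 1 \<Longrightarrow> diff_integral \<mu> \<nu> f \<le> s"
  shows "W1 A \<mu> \<nu> \<le> ennreal s"
proof (rule ennreal_le_epsilon)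
  fix r :: real assume r: "0 < r"
  define M N where "M = rel_rep \<mu>" and "N = rel_rep \<nu>"
  note MD = M1_D[OF A(1) \<mu>, folded M_def] and ND = M1_D[OF A(1) \<nu>, folded N_def]
  have Ab: "A \<in> sets borel" "- A \<in> sets borel"
    using A by auto
  have infm: "(\<lambda>x. infdist x A) \<in> borel_measurable borel"
    by (intro borel_measurable_continuous_onI continuous_intros)
  obtain a where a: "a \<in> A"
    using A by auto
  define CM CN where "CM = (LINT z|M. infdist z A)" and "CN = (LINT z|N. infdist z A)"
  have C0: "0 \<le> CM" "0 \<le> CN"
    by (auto simp: CM_def CN_def infdist_nonneg)
  have CM: "(\<integral>\<^sup>+z. ennreal (infdist z A) \<partial>M) = ennreal CM" and CN: "(\<integral>\<^sup>+z. ennreal (infdist z A) \<partial>N) = ennreal CN"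
    unfolding CM_def CN_def using MD ND by (auto intro!: nn_integral_eq_integral simp: infdist_nonneg)
  \<comment> \<open>One sixth of r goes to \<open>e * (CM + CN)\<close> and one sixth to each of the
    two tails. The bound 1/2 secures \<open>e < 1\<close>, and the summand 1 keeps the denominator
    positive.\<close>
  define e where "e = min (1/2) (r / (6 * (CM + CN + 1)))"
  have e: "0 < e" "e < 1"
    using r C0 by (auto simp: e_def)
  have "e * (CM + CN + 1) \<le> r / (6 * (CM + CN + 1)) * (CM + CN + 1)"
    using C0 by (intro mult_right_mono) (auto simp: e_def)
  also have "\<dots> = r / 6"
    using C0 by (simp add: field_simps)
  finally have eC: "e * (CM + CN) \<le> r / 6"
    using e by (simp add: distrib_left)
  obtain U x where U: "\<And>i::nat. U i \<in> sets borel" "disjoint_family U" "(\<Union>i. U i) = - A"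
    and near: "\<And>i z. z \<in> U i \<Longrightarrow> dist z (x i) \<le> e * infdist z A"
    and pos: "\<And>i. \<exists>r>0. \<forall>z\<in>U i. r \<le> infdist z A"
    using Whitney_partition[OF A e] by metis
  \<comment> \<open>Markov's inequality, as \<open>infdist _ A\<close> is bounded below on
    \<open>U i\<close>.\<close>
  have fin: "emeasure Q (U i) < \<infinity>"
    if Q: "sets Q = sets borel" "(\<integral>\<^sup>+z. ennreal (infdist z A) \<partial>Q) < \<infinity>" for Q i
  proof -
    obtain t where t: "t > 0" "\<forall>z\<in>U i. t \<le> infdist z A"
      using pos by blast
    have [measurable]: "(\<lambda>x. infdist x A) \<in> borel_measurable Q" "U i \<in> sets Q"
      using infm Q U by (simp_all cong: measurable_cong_sets)
    have "ennreal t * emeasure Q (U i) = (\<integral>\<^sup>+z. ennreal t * indicator (U i) z \<partial>Q)"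
      by (simp add: nn_integral_cmult)
    also have "\<dots> \<le> (\<integral>\<^sup>+z. ennreal (infdist z A) \<partial>Q)"
      using t by (intro nn_integral_mono) (auto simp: indicator_def ennreal_leI)
    also have "\<dots> < \<infinity>"
      by (rule Q)
    finally show ?thesis
      using t by (auto simp: ennreal_mult_less_top)
  qed
  define R where "R = (\<lambda>k. - A - (\<Union>i<k. U i))"
  have tail: "\<forall>\<^sub>F k in sequentially. (\<integral>\<^sup>+z. indicator (R k) z * ennreal (infdist z A) \<partial>Q) < ennreal (r / 6)"
    if "sets Q = sets borel" "(\<integral>\<^sup>+z. ennreal (infdist z A) \<partial>Q) < \<infinity>" for Q
  proof -
    have "(\<lambda>k. \<integral>\<^sup>+z. indicator (R k) z * ennreal (infdist z A) \<partial>Q) \<longlonglongrightarrow> 0"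
      unfolding R_def using that infm by (intro tail_integral_tendsto_0 Ab U) auto
    then show ?thesis
      using r by (intro order_tendstoD) auto
  qed
  obtain k where k: "(\<integral>\<^sup>+z. indicator (R k) z * ennreal (infdist z A) \<partial>M) < ennreal (r / 6)"
      "(\<integral>\<^sup>+z. indicator (R k) z * ennreal (infdist z A) \<partial>N) < ennreal (r / 6)"
    using eventually_conj[OF tail[OF MD(2,3)] tail[OF ND(2,3)]] by (auto dest: eventually_happens)
  define I where "I = {..<k}"
  have Rk: "R k = - A - (\<Union>i\<in>I. U i)"
    by (simp add: R_def I_def)
  have Rb: "R k \<in> sets borel"
    unfolding R_def using Ab U by (intro sets.Diff sets.finite_UN) auto
  have I: "finite I" "disjoint_family_on U I"
    using U(2) by (auto simp: I_def disjoint_family_on_def)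
  have UA: "U i \<subseteq> - A" for i
    using U(3) by auto
  define TM TN where "TM = (LINT z|M. indicator (R k) z * infdist z A)" and "TN = (LINT z|N. indicator (R k) z * infdist z A)"
  have T: "(\<integral>\<^sup>+z. indicator (R k) z * ennreal (infdist z A) \<partial>Q) = ennreal (LINT z|Q. indicator (R k) z * infdist z A)"
    if "sets Q = sets borel" "integrable Q (\<lambda>z. infdist z A)" for Q
  proof -
    have "integrable Q (\<lambda>z. indicator (R k) z * infdist z A)"
      using integrable_real_mult_indicator[of "R k" Q "\<lambda>z. infdist z A"] Rb that by (simp add: mult.commute)
    then show ?thesis
      by (subst nn_integral_eq_integral[symmetric])
        (auto simp: infdist_nonneg indicator_def intro!: nn_integral_cong)
  qed
  have TM: "TM \<le> r / 6" "TN \<le> r / 6"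
    using k T[OF MD(2,4)] T[OF ND(2,4)] r by (auto simp: TM_def TN_def ennreal_less_iff infdist_nonneg less_imp_le)
  define \<delta> where "\<delta> = e * CM + TM + (e * CN + TN)"
  have \<delta>: "\<delta> \<le> r / 2"
    using eC TM by (simp add: \<delta>_def algebra_simps)
  define m n where "m = (\<lambda>i. measure M (U i))" and "n = (\<lambda>i. measure N (U i))"
  have m: "emeasure M (U i) = ennreal (m i)" "0 \<le> m i" for i
    using fin[OF MD(2,3), of i] by (simp_all add: m_def emeasure_eq_ennreal_measure)
  have n: "emeasure N (U i) = ennreal (n i)" "0 \<le> n i" for i
    using fin[OF ND(2,3), of i] by (simp_all add: n_def emeasure_eq_ennreal_measure)
  obtain l u v where l: "\<And>i j. i \<in> I \<Longrightarrow> j \<in> I \<Longrightarrow> 0 \<le> l i j"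
    and u: "\<And>i. i \<in> I \<Longrightarrow> 0 \<le> u i" "\<And>i. i \<in> I \<Longrightarrow> (\<Sum>j\<in>I. l i j) + u i = m i"
    and v: "\<And>i. i \<in> I \<Longrightarrow> 0 \<le> v i" "\<And>j. j \<in> I \<Longrightarrow> (\<Sum>i\<in>I. l i j) + v j = n j"
    and cost: "(\<Sum>i\<in>I. \<Sum>j\<in>I. l i j * dbar A (x i) (x j)) + (\<Sum>i\<in>I. u i * infdist (x i) A)
      + (\<Sum>i\<in>I. v i * infdist (x i) A) \<le> s + \<delta>"
  proof (rule partial_transport_duality[of I m n "\<lambda>i j. dbar A (x i) (x j)" "\<lambda>i. infdist (x i) A" "s + \<delta>"])
    show "finite I" by (rule I)
    fix f g :: "nat \<Rightarrow> real"
    assume f: "\<And>i j. i \<in> I \<Longrightarrow> j \<in> I \<Longrightarrow> f i - g j \<le> dbar A (x i) (x j)"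
      "\<And>i. i \<in> I \<Longrightarrow> f i \<le> infdist (x i) A" "\<And>i. i \<in> I \<Longrightarrow> - g i \<le> infdist (x i) A"
    obtain F where F: "1-lipschitz_on UNIV F" "\<And>z. z \<in> A \<Longrightarrow> F z = 0"
      "\<And>i. i \<in> I \<Longrightarrow> f i \<le> F (x i)" "\<And>i. i \<in> I \<Longrightarrow> F (x i) \<le> g i"
      using potential_extension[where f=f and g=g and x=x, OF I(1) A(2) f] by blast
    have "(\<Sum>i\<in>I. m i * f i) \<le> (LINT z|M. F z) + e * CM + TM"
      unfolding CM_def TM_def Rk
      by (rule step_integral_le[OF MD(2) Ab(1) A(2) I(1) U(1) I(2) near _ m MD(4) F(1,2,3)]) (use e in auto)
    \<comment> \<open>The same estimate for \<open>- F\<close>, using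
      \<open>F (x i) \<le> g i\<close>.\<close>
    moreover have "(\<Sum>i\<in>I. n i * - g i) \<le> (LINT z|N. - F z) + e * CN + TN"
      unfolding CN_def TN_def Rk
      by (rule step_integral_le[OF ND(2) Ab(1) A(2) I(1) U(1) I(2) near _ n ND(4)])
        (use e F in \<open>auto intro: lipschitz_on_minus\<close>)
    moreover have "F \<in> Lip A"
      using F by (auto simp: Lip_def)
    then have "(LINT z|M. F z) - (LINT z|N. F z) \<le> s"
      using s[of F] F(1) by (simp add: lip_number_le_iff diff_integral_def rel_integral_def M_def N_def)
    ultimately show "(\<Sum>i\<in>I. m i * f i) - (\<Sum>i\<in>I. n i * g i) \<le> s + \<delta>"
      by (simp add: sum_negf \<delta>_def)
  qed (use m n in auto)
  have "\<exists>\<pi>. sets \<pi> = sets borel \<and>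
    (\<forall>E\<in>sets borel. E \<subseteq> - A \<longrightarrow> emeasure (distr \<pi> borel fst) E = emeasure M E) \<and>
    (\<forall>E\<in>sets borel. E \<subseteq> - A \<longrightarrow> emeasure (distr \<pi> borel snd) E = emeasure N E) \<and>
    (\<integral>\<^sup>+z. ennreal (dbar A (fst z) (snd z)) \<partial>\<pi>) \<le>
      ennreal ((\<Sum>i\<in>I. \<Sum>j\<in>I. l i j * dbar A (x i) (x j)) +
        (\<Sum>i\<in>I. u i * infdist (x i) A) + (\<Sum>i\<in>I. v i * infdist (x i) A))
      + (ennreal e * (\<integral>\<^sup>+z. ennreal (infdist z A) \<partial>M) + (\<integral>\<^sup>+z. indicator (R k) z * ennreal (infdist z A) \<partial>M))
      + (ennreal e * (\<integral>\<^sup>+z. ennreal (infdist z A) \<partial>N) + (\<integral>\<^sup>+z. indicator (R k) z * ennreal (infdist z A) \<partial>N))"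
    (is "\<exists>\<pi>. _ \<and> _ \<and> _ \<and> ?cost \<pi>")
    unfolding Rk
    by (rule exists_plan[OF MD(2) ND(2) Ab(1) a I(1) U(1) UA I(2) near less_imp_le[OF e(1)] m n l u v])
  then obtain \<pi> where \<pi>: "sets \<pi> = sets borel"
    "\<forall>E\<in>sets borel. E \<subseteq> - A \<longrightarrow> emeasure (distr \<pi> borel fst) E = emeasure M E"
    "\<forall>E\<in>sets borel. E \<subseteq> - A \<longrightarrow> emeasure (distr \<pi> borel snd) E = emeasure N E"
    and c\<pi>: "?cost \<pi>"
    by (elim exE conjE)
  have AA: "A \<times> A \<in> sets borel"
    using A(1) by (intro borel_closed closed_Times)
  define P where "P = rel_measure_eq (A \<times> A) `` {\<pi>}"
  have P: "P \<in> relative_measures (A \<times> A)" "\<pi> \<in> P"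
    using \<pi>(1) equiv_class_self[OF equiv_rel_measure_eq[OF AA]]
    by (auto simp: P_def relative_measures_def borel_measures_def intro!: quotientI)
  have "fst \<in> borel_measurable (borel :: ('a \<times> 'a) measure)" "snd \<in> borel_measurable (borel :: ('a \<times> 'a) measure)"
    by (intro borel_measurable_continuous_onI continuous_intros)+
  then have "rel_push A fst P = rel_measure_eq A `` {distr \<pi> borel fst}"
    and "rel_push A snd P = rel_measure_eq A `` {distr \<pi> borel snd}"
    by (intro rel_push_eq(1)[OF AA Ab(1) P]; force)+
  moreover have "rel_measure_eq A `` {distr \<pi> borel fst} = \<mu>"
    using \<pi>(2) by (intro relative_measure_eqI[OF Ab(1) MD(1)]) (simp_all add: M_def)
  moreover have "rel_measure_eq A `` {distr \<pi> borel snd} = \<nu>"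
    using \<pi>(3) by (intro relative_measure_eqI[OF Ab(1) ND(1)]) (simp_all add: N_def)
  ultimately have "P \<in> couplings A \<mu> \<nu>"
    using P(1) by (simp add: couplings_def)
  then have "W1 A \<mu> \<nu> \<le> rel_nn_integral P (\<lambda>(x, y). ennreal (dbar A x y))"
    unfolding W1_def by (rule INF_lower)
  also have "\<dots> = (\<integral>\<^sup>+z. ennreal (dbar A (fst z) (snd z)) \<partial>\<pi>)"
    by (subst rel_nn_integral_eq[OF AA P]) (auto simp: dbar_left split_def)
  also have "\<dots> \<le> ennreal (s + \<delta>) + (ennreal e * (\<integral>\<^sup>+z. ennreal (infdist z A) \<partial>M) + (\<integral>\<^sup>+z. indicator (R k) z * ennreal (infdist z A) \<partial>M))
      + (ennreal e * (\<integral>\<^sup>+z. ennreal (infdist z A) \<partial>N) + (\<integral>\<^sup>+z. indicator (R k) z * ennreal (infdist z A) \<partial>N))"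
    by (rule order_trans[OF c\<pi>]) (intro add_right_mono ennreal_leI cost)
  also have "\<dots> = ennreal (s + \<delta>) + ennreal \<delta>"
  proof -
    have "0 \<le> TM" "0 \<le> TN"
      by (auto simp: TM_def TN_def infdist_nonneg)
    then show ?thesis
      using C0 e by (simp add: CM CN T[OF MD(2,4)] T[OF ND(2,4)] \<delta>_def add.assoc flip: TM_def TN_def ennreal_mult ennreal_plus)
  qed
  also have "\<dots> \<le> (ennreal s + ennreal (r / 2)) + ennreal (r / 2)"
  proof -
    \<comment> \<open>The zero potential shows \<open>0 \<le> s\<close>, without which
      \<open>ennreal\<close> would truncate \<open>s\<close> and the sum could not be split.\<close>
    have "(\<lambda>_. 0) \<in> Lip A"
      by (auto simp: Lip_def intro!: exI[of _ 0] lipschitz_onI)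
    then have "0 \<le> s"
      using s[of "\<lambda>_. 0"] by (auto simp: lip_number_le_iff lipschitz_on_def diff_integral_def rel_integral_def)
    then have "ennreal (s + \<delta>) \<le> ennreal s + ennreal (r / 2)"
      using \<delta> r by (simp add: ennreal_leI flip: ennreal_plus)
    then show ?thesis
      using \<delta> by (intro add_mono ennreal_leI)
  qed
  also have "\<dots> = ennreal s + ennreal r"
    using r by (simp add: add.assoc flip: ennreal_plus)
  finally show "W1 A \<mu> \<nu> \<le> ennreal s + ennreal r" .
qed

text \<open>Subtracting under one integral requires \<open>f\<close> to be integrable along each
  coordinate of the coupling. The marginals are prescribed only off \<open>A\<close>, but that
  determines integrals of functions vanishing on \<open>A\<close>.\<close>

lemma diff_integral_le_W1:
  fixes A :: "'a::polish_space set"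
  assumes A: "closed A" "A \<noteq> {}" and \<mu>: "\<mu> \<in> M1 A" and \<nu>: "\<nu> \<in> M1 A"
    and f: "f \<in> Lip A" "lip_number f \<le> 1"
  shows "ennreal (diff_integral \<mu> \<nu> f) \<le> W1 A \<mu> \<nu>"
  unfolding W1_def
proof (rule INF_greatest)
  fix P assume P: "P \<in> couplings A \<mu> \<nu>"
  note MD = M1_D[OF A(1) \<mu>] and ND = M1_D[OF A(1) \<nu>]
  have Ab: "A \<in> sets borel" "A \<times> A \<in> sets borel"
    using A(1) by (auto intro!: borel_closed closed_Times)
  have PR: "P \<in> relative_measures (A \<times> A)" and push: "rel_push A fst P = \<mu>" "rel_push A snd P = \<nu>"
    using P by (auto simp: couplings_def)
  define Q where "Q = rel_rep P"
  have sQ: "sets Q = sets borel"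
    unfolding Q_def using Ab PR by (intro sets_rel_rep)
  have pm: "fst \<in> borel_measurable Q" "snd \<in> borel_measurable Q"
    using sQ by (auto intro!: borel_measurable_continuous_onI continuous_intros cong: measurable_cong_sets)
  have lf: "1-lipschitz_on UNIV f" and f0: "\<And>x. x \<in> A \<Longrightarrow> f x = 0"
    using f by (auto simp: lip_number_le_iff[OF f(1)] Lip_def)
  have fm: "f \<in> borel_measurable borel"
    using borel_measurable_continuous_onI[OF lipschitz_on_continuous_on[OF lf]] .
  have proj: "integrable Q (\<lambda>z. f (p z)) \<and> rel_integral \<rho> f = (LINT z|Q. f (p z))"
    if p: "p \<in> borel_measurable Q" and \<rho>: "\<rho> \<in> M1 A" "rel_push A p P = \<rho>" for p \<rho>
  proof -
    note RD = M1_D[OF A(1) \<rho>(1)]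
    have "distr Q borel p \<in> \<rho>"
      using \<rho>(2) equiv_class_self[OF equiv_rel_measure_eq[OF Ab(1)], of "distr Q borel p"]
      by (auto simp: rel_push_def Q_def borel_measures_def)
    note e1 = rel_nn_integral_eq[OF Ab(1) RD(1) this, of "\<lambda>x. ennreal \<bar>f x\<bar>"]
      and e2 = rel_integral_eq[OF Ab(1) RD(1) this, of f]
    have "(\<integral>\<^sup>+x. ennreal \<bar>f x\<bar> \<partial>distr Q borel p) < \<infinity>"
      using integrable_Lip[OF A \<rho>(1) f(1)] e1 f0 by (simp add: rel_nn_integral_def integrable_iff_bounded)
    then have "integrable (distr Q borel p) f"
      using fm by (simp add: integrable_iff_bounded)
    then show ?thesis
      using p fm e2 f0 by (simp add: integrable_distr_eq integral_distr)
  qed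
  have i1: "integrable Q (\<lambda>z. f (fst z))" "rel_integral \<mu> f = (LINT z|Q. f (fst z))"
    using proj[OF pm(1) \<mu> push(1)] by auto
  have i2: "integrable Q (\<lambda>z. f (snd z))" "rel_integral \<nu> f = (LINT z|Q. f (snd z))"
    using proj[OF pm(2) \<nu> push(2)] by auto
  \<comment> \<open>The Lipschitz bound gives the first term of the minimum; vanishing on
    \<open>A\<close> gives the second.\<close>
  have le: "f x - f y \<le> dbar A x y" for x y
    using lipschitz_onD[OF lf, of x y] Lip_bound[OF lf f0 A(2), of x] Lip_bound[OF lf f0 A(2), of y]
    by (auto simp: dbar_def dist_real_def abs_le_iff)
  have "ennreal (diff_integral \<mu> \<nu> f) = ennreal (LINT z|Q. f (fst z) - f (snd z))"
    using i1 i2 by (simp add: diff_integral_def)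
  \<comment> \<open>The positive part allows the change to \<open>nn_integral\<close>, in which the
    cost of the coupling may be infinite.\<close>
  also have "\<dots> \<le> ennreal (LINT z|Q. max 0 (f (fst z) - f (snd z)))"
    using i1 i2 by (intro ennreal_leI integral_mono) auto
  also have "\<dots> = (\<integral>\<^sup>+z. ennreal (max 0 (f (fst z) - f (snd z))) \<partial>Q)"
    using i1 i2 by (intro nn_integral_eq_integral[symmetric]) auto
  also have "\<dots> \<le> (\<integral>\<^sup>+z. ennreal (dbar A (fst z) (snd z)) \<partial>Q)"
    using le dbar_nonneg by (intro nn_integral_mono ennreal_leI) auto
  also have "\<dots> = rel_nn_integral P (\<lambda>(x, y). ennreal (dbar A x y))"
    by (simp add: rel_nn_integral_def Q_def split_def)
  finally show "ennreal (diff_integral \<mu> \<nu> f) \<le> rel_nn_integral P (\<lambda>(x, y). ennreal (dbar A x y))" .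
qed

text \<open>The supremum is taken in \<open>ereal\<close> because single values of the functional
  may be negative. It agrees with the operator norm, defined by absolute values, because the unit
  ball is symmetric under \<open>f \<mapsto> - f\<close>.\<close>

theorem theorem1p8:
  fixes A :: "'a::polish_space set" and \<mu> \<nu> :: "'a relative_measure"
  assumes "closed A" and "A \<noteq> {}"
    and "\<forall>S::'a set. closed S \<and> bounded S \<longrightarrow> compact S"
    and "\<mu> \<in> M1 A" and "\<nu> \<in> M1 A"
  shows "enn2ereal (W1 A \<mu> \<nu>) =
           (SUP f\<in>{f \<in> Lip A. lip_number f \<le> 1}. ereal (diff_integral \<mu> \<nu> f))
       \<and> W1 A \<mu> \<nu> = lip_onorm A (diff_integral \<mu> \<nu>)"
proof -
  note A = assms(1,2) and \<mu> = assms(4) and \<nu> = assms(5)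
  let ?B = "{f \<in> Lip A. lip_number f \<le> 1}"
  let ?\<phi> = "diff_integral \<mu> \<nu>"
  have B: "f \<in> ?B \<longleftrightarrow> 1-lipschitz_on UNIV f \<and> (\<forall>x\<in>A. f x = 0)" for f
    using lip_number_le_iff[of f A 1] by (auto simp: Lip_def)
  have upper: "ennreal (?\<phi> f) \<le> W1 A \<mu> \<nu>" if "f \<in> ?B" for f
    using diff_integral_le_W1[OF A \<mu> \<nu>] that by auto
  have lower: "W1 A \<mu> \<nu> \<le> ennreal s" if "\<And>f. f \<in> ?B \<Longrightarrow> ?\<phi> f \<le> s" for s
    using W1_le[OF A \<mu> \<nu>] that by auto
  have zero: "(\<lambda>_. 0) \<in> ?B" "?\<phi> (\<lambda>_. 0) = 0"
    unfolding B by (auto simp: B lipschitz_on_def diff_integral_def rel_integral_def)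
  have neg: "(\<lambda>x. - f x) \<in> ?B" "?\<phi> (\<lambda>x. - f x) = - ?\<phi> f" if "f \<in> ?B" for f
    using that unfolding B by (auto simp: diff_integral_def rel_integral_def intro: lipschitz_on_minus)
  \<comment> \<open>A uniform real bound on the dual values makes \<open>W1 A \<mu> \<nu>\<close>
    finite, so both suprema can be compared with a real number \<open>w\<close>.\<close>
  have "?\<phi> f \<le> (LINT z|rel_rep \<mu>. infdist z A) + (LINT z|rel_rep \<nu>. infdist z A)" if "f \<in> ?B" for f
  proof -
    have f: "f \<in> Lip A" "1-lipschitz_on UNIV f" "\<And>x. x \<in> A \<Longrightarrow> f x = 0"
      using that B by auto
    have b: "f z \<le> infdist z A" "- f z \<le> infdist z A" for z
      using Lip_bound[OF f(2,3) A(2), of z] by (auto simp: abs_le_iff)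
    have "(LINT z|rel_rep \<mu>. f z) \<le> (LINT z|rel_rep \<mu>. infdist z A)"
      by (rule integral_mono[OF integrable_Lip[OF A \<mu> f(1)] M1_D(4)[OF A(1) \<mu>] b(1)])
    moreover have "(LINT z|rel_rep \<nu>. - f z) \<le> (LINT z|rel_rep \<nu>. infdist z A)"
      by (rule integral_mono[OF integrable_minus[OF integrable_Lip[OF A \<nu> f(1)]] M1_D(4)[OF A(1) \<nu>] b(2)])
    ultimately show ?thesis
      by (simp add: diff_integral_def rel_integral_def)
  qed
  from lower[OF this] obtain w where w: "W1 A \<mu> \<nu> = ennreal w" "0 \<le> w"
    by (cases "W1 A \<mu> \<nu>") (auto simp: top_unique)
  have le: "?\<phi> f \<le> w" if "f \<in> ?B" for f
    using upper[OF that] w by (simp add: ennreal_le_iff)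
  have least: "w \<le> s" if "\<And>f. f \<in> ?B \<Longrightarrow> ?\<phi> f \<le> s" for s
    using lower[OF that] w that[OF zero(1)] zero(2) by (simp add: ennreal_le_iff)
  have "(SUP f\<in>?B. ereal (?\<phi> f)) = ereal w"
  proof (rule SUP_eqI)
    show "ereal w \<le> y" if "\<And>f. f \<in> ?B \<Longrightarrow> ereal (?\<phi> f) \<le> y" for y
    proof (cases y)
      case (real r)
      then show ?thesis
        using least[of r] that by simp
    next
      case MInf
      then show ?thesis
        using that[OF zero(1)] zero(2) by simp
    qed simp
  qed (use le in simp)
  moreover have "lip_onorm A ?\<phi> = ennreal w"
    unfolding lip_onorm_def
  proof (rule SUP_eqI)
    show "ennreal \<bar>?\<phi> f\<bar> \<le> ennreal w" if "f \<in> ?B" for f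
      using le[OF that] le[OF neg(1)[OF that]] neg(2)[OF that] by (intro ennreal_leI) simp
    show "ennreal w \<le> y" if y: "\<And>f. f \<in> ?B \<Longrightarrow> ennreal \<bar>?\<phi> f\<bar> \<le> y" for y
    proof (cases y)
      case (real r)
      then have "\<bar>?\<phi> f\<bar> \<le> r" if "f \<in> ?B" for f
        using y[OF that] by (simp add: ennreal_le_iff)
      then have "w \<le> r"
        by (intro least) (meson abs_ge_self order_trans)
      then show ?thesis
        using real by (simp add: ennreal_leI)
    qed simp
  qed
  ultimately show ?thesis
    using w by simp
qed

end
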